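(* There exists an algorithm which, given a finite point set $T$ in the plane with $|T|=k=2m+1$ ($m\geq 1$) and $|CH(T)|=h$, determines in $O(hk\log k)$ time whether $T$ belongs to the extension $\mathcal{A}(S)$ of some reflection symmetric point set $S$, and (if so) whether the Fermat-Weber point of $T$ coincides with the pivot point of $\mathcal{A}(S)$.
   Context: The Fermat-Weber point of a finite set $S=\{p_1,\dots,p_r\}$ of points in the plane $\mathbb{R}^2$ is the point $p\in\mathbb{R}^2$ minimizing $\sum_{i=1}^r d(p,p_i)$, where $d$ is the Euclidean distance; it is unique when the points of $S$ are not all collinear. For a finite point set $Z$, $CH(Z)$ denotes its convex hull and $|CH(Z)|$ the number of points of $Z$ that are vertices of the convex hull. A set $S$ of $k=2m+1$ ($m\ge 1$) points in the plane lying on the circumference of a unit circle with center $o$ is reflection symmetric if there exists a point $s_0\in S$ such that for every $s_i\in S\setminus\{s_0\}$, which lies in one of the two open halfplanes determined by the line $os_0$, the reflection $s_i'$ of $s_i$ about the line $os_0$ (lying in the other open halfplane) belongs to $S\setminus\{s_0,s_i\}$. The point $s_0$ is called the pivot of $S$ (a reflection symmetric set is considered together with its pivot). The extension $\mathcal{A}(S)$ of $S$ is the set of all $k$-element point sets obtained from $S$ by keeping $s_0$ fixed and moving each point $s\in S\setminus\{s_0\}$ along the ray starting at $s_0$ and passing through $s$ (to a point of that ray different from $s_0$), i.e. all sets $\{s_0\}\cup\{s_0+t_s(s-s_0): s\in S\setminus\{s_0\}\}$ with $t_s>0$. The point $s_0$ belongs to every $T\in\mathcal{A}(S)$ and is called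 the pivot point of $\mathcal{A}(S)$. Running time is measured in the usual model of computational geometry (real RAM, where arithmetic operations, comparisons, square roots and elementary geometric primitives on real numbers have unit cost). *)

theory Defs
  imports "HOL-Analysis.Analysis"
begin

section \<open>Fermat-Weber points, reflection symmetric sets and extensions\<close>

definition hull_size :: "(real^2) set \<Rightarrow> nat" where
  "hull_size Z = card {z \<in> Z. z extreme_point_of (convex hull Z)}"

definition fermat_weber_point :: "(real^2) set \<Rightarrow> real^2 \<Rightarrow> bool" where
  "fermat_weber_point S p \<longleftrightarrow> is_arg_min (\<lambda>q. \<Sum>s\<in>S. dist q s) (\<lambda>_. True) p"

text \<open>The mirror image of \<open>x\<close> in the line through \<open>a\<close> and \<open>b\<close>, for \<open>a \<noteq> b\<close>:
  the component of \<open>x - a\<close> along \<open>b - a\<close> is kept, the orthogonal one is negated.\<close>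

definition reflect_in_line :: "real^2 \<Rightarrow> real^2 \<Rightarrow> real^2 \<Rightarrow> real^2" where
  "reflect_in_line a b x =
     a + (2 * (((x - a) \<bullet> (b - a)) / ((b - a) \<bullet> (b - a)))) *\<^sub>R (b - a) - (x - a)"

text \<open>A point lies in one of the two open halfplanes bounded by a line iff it is not on the
  line; its mirror image is then in the other one.\<close>

definition reflection_symmetric :: "(real^2) set \<Rightarrow> real^2 \<Rightarrow> bool" where
  "reflection_symmetric S s0 \<longleftrightarrow>
     finite S \<and> (\<exists>m\<ge>1. card S = 2 * m + 1) \<and> s0 \<in> S \<and>
     (\<exists>c. S \<subseteq> sphere c 1 \<and>
        (\<forall>s\<in>S - {s0}. s \<notin> affine hull {c, s0} \<and> reflect_in_line c s0 s \<in> S - {s0, s}))"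

definition extension :: "(real^2) set \<Rightarrow> real^2 \<Rightarrow> (real^2) set set" where
  "extension S s0 =
     {insert s0 ((\<lambda>s. s0 + t s *\<^sub>R (s - s0)) ` (S - {s0})) | t. \<forall>s\<in>S - {s0}. 0 < t s}"

lemma fermat_weber_point_unique:
  assumes "finite S" and "\<not> collinear S"
    and p: "fermat_weber_point S p" and q: "fermat_weber_point S q"
  shows "p = q"
proof (rule ccontr)
  assume "p \<noteq> q"
  define r where "r = midpoint p q"
  let ?f = "\<lambda>x. \<Sum>s\<in>S. dist x s"
  have min: "?f p \<le> ?f x" "?f q \<le> ?f x" for x
    using p q by (auto simp: fermat_weber_point_def is_arg_min_linorder)
  have mid: "2 * dist r s = norm ((p - s) + (q - s))" for s
  proof -
    have "(p - s) + (q - s) = 2 *\<^sub>R (r - s)"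
      by (simp add: r_def midpoint_def algebra_simps flip: scaleR_2)
    then show ?thesis by (simp add: dist_norm)
  qed
  have le: "2 * dist r s \<le> dist p s + dist q s" for s
    unfolding mid[of s] unfolding dist_norm by (rule norm_triangle_ineq)
  have "\<exists>s\<in>S. 2 * dist r s < dist p s + dist q s"
  proof (rule ccontr)
    assume "\<not> ?thesis"
    then have ge: "dist p s + dist q s \<le> 2 * dist r s" if "s \<in> S" for s
      using that by (meson not_less)
    have eq: "norm ((p - s) + (q - s)) = norm (p - s) + norm (q - s)" if "s \<in> S" for s
      using order_antisym[OF le ge[OF that]] mid[of s] by (simp add: dist_norm)
    have "s \<in> affine hull {p, q}" if "s \<in> S" for s
    proof -
      have par: "norm (p - s) *\<^sub>R (q - s) = norm (q - s) *\<^sub>R (p - s)"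
        using eq[OF that] norm_triangle_eq by blast
      define a b where "a = norm (p - s)" and "b = norm (q - s)"
      have "a \<noteq> b"
      proof
        assume "a = b"
        with par \<open>p \<noteq> q\<close> have "a = 0" by (auto simp: a_def b_def)
        with \<open>a = b\<close> \<open>p \<noteq> q\<close> show False by (auto simp: a_def b_def)
      qed
      have "(a - b) *\<^sub>R s = a *\<^sub>R q - b *\<^sub>R p"
        using par by (simp add: a_def b_def algebra_simps)
      also have "\<dots> = (a - b) *\<^sub>R ((- b / (a - b)) *\<^sub>R p + (a / (a - b)) *\<^sub>R q)"
        using \<open>a \<noteq> b\<close> by (simp add: scaleR_right_diff_distrib)
      finally have "s = (- b / (a - b)) *\<^sub>R p + (a / (a - b)) *\<^sub>R q"
        using \<open>a \<noteq> b\<close> by simp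
      moreover have "- b / (a - b) + a / (a - b) = 1"
        using \<open>a \<noteq> b\<close> diff_divide_distrib[of a b "a - b"] by simp
      ultimately show ?thesis
        unfolding affine_hull_2 by blast
    qed
    then have "collinear S"
      unfolding collinear_affine_hull by blast
    with assms(2) show False ..
  qed
  then have "(\<Sum>s\<in>S. 2 * dist r s) < (\<Sum>s\<in>S. dist p s + dist q s)"
    using \<open>finite S\<close> le by (meson sum_strict_mono_ex1)
  then have "2 * ?f r < ?f p + ?f q"
    by (simp add: sum.distrib sum_distrib_left)
  with min[of r] show False by linarith
qed


section \<open>A real RAM\<close>

text \<open>Programs operate on two disjoint memories, one of natural numbers and one of real numbers;
  each is divided into named arrays with unbounded index range.  Scalars are kept at index 0.
  Array indices are computed and may themselves be read from memory (indirect addressing).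
  Data may only flow from the real memory to the numbers through comparisons: there is no rounding
  operation, and natural numbers can only be added, subtracted and compared.  Every memory
  access, constant, arithmetic operation, square root and comparison costs one unit.\<close>

datatype nexp =
    NConst nat
  | NLoad string nexp
  | NAdd nexp nexp
  | NSub nexp nexp

datatype rexp =
    RConst int
  | RLoad string nexp
  | RAdd rexp rexp
  | RSub rexp rexp
  | RMul rexp rexp
  | RDiv rexp rexp
  | RSqrt rexp

datatype bexp =
    NLess nexp nexp
  | NEq nexp nexp
  | RLess rexp rexp
  | REq rexp rexp
  | BNot bexp
  | BAnd bexp bexp

datatype com =
    Skip
  | NStore string nexp nexp
  | RStore string nexp rexp
  | Seq com com
  | Cond bexp com com
  | Loop bexp com

record state =
  nats :: "string \<Rightarrow> nat \<Rightarrow> nat"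
  reals :: "string \<Rightarrow> nat \<Rightarrow> real"

fun nval :: "nexp \<Rightarrow> state \<Rightarrow> nat" where
  "nval (NConst n) s = n"
| "nval (NLoad x i) s = nats s x (nval i s)"
| "nval (NAdd a b) s = nval a s + nval b s"
| "nval (NSub a b) s = nval a s - nval b s"

fun rval :: "rexp \<Rightarrow> state \<Rightarrow> real" where
  "rval (RConst z) s = of_int z"
| "rval (RLoad x i) s = reals s x (nval i s)"
| "rval (RAdd a b) s = rval a s + rval b s"
| "rval (RSub a b) s = rval a s - rval b s"
| "rval (RMul a b) s = rval a s * rval b s"
| "rval (RDiv a b) s = rval a s / rval b s"
| "rval (RSqrt a) s = sqrt (rval a s)"

fun bval :: "bexp \<Rightarrow> state \<Rightarrow> bool" where
  "bval (NLess a b) s \<longleftrightarrow> nval a s < nval b s"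
| "bval (NEq a b) s \<longleftrightarrow> nval a s = nval b s"
| "bval (RLess a b) s \<longleftrightarrow> rval a s < rval b s"
| "bval (REq a b) s \<longleftrightarrow> rval a s = rval b s"
| "bval (BNot b) s \<longleftrightarrow> \<not> bval b s"
| "bval (BAnd b c) s \<longleftrightarrow> bval b s \<and> bval c s"

fun ncost :: "nexp \<Rightarrow> nat" where
  "ncost (NConst n) = 1"
| "ncost (NLoad x i) = ncost i + 1"
| "ncost (NAdd a b) = ncost a + ncost b + 1"
| "ncost (NSub a b) = ncost a + ncost b + 1"

fun rcost :: "rexp \<Rightarrow> nat" where
  "rcost (RConst z) = 1"
| "rcost (RLoad x i) = ncost i + 1"
| "rcost (RAdd a b) = rcost a + rcost b + 1"
| "rcost (RSub a b) = rcost a + rcost b + 1"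
| "rcost (RMul a b) = rcost a + rcost b + 1"
| "rcost (RDiv a b) = rcost a + rcost b + 1"
| "rcost (RSqrt a) = rcost a + 1"

fun bcost :: "bexp \<Rightarrow> nat" where
  "bcost (NLess a b) = ncost a + ncost b + 1"
| "bcost (NEq a b) = ncost a + ncost b + 1"
| "bcost (RLess a b) = rcost a + rcost b + 1"
| "bcost (REq a b) = rcost a + rcost b + 1"
| "bcost (BNot b) = bcost b + 1"
| "bcost (BAnd b c) = bcost b + bcost c + 1"

definition nstore :: "string \<Rightarrow> nat \<Rightarrow> nat \<Rightarrow> state \<Rightarrow> state" where
  "nstore x i v s = s\<lparr>nats := (nats s)(x := (nats s x)(i := v))\<rparr>"

definition rstore :: "string \<Rightarrow> nat \<Rightarrow> real \<Rightarrow> state \<Rightarrow> state" where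
  "rstore x i v s = s\<lparr>reals := (reals s)(x := (reals s x)(i := v))\<rparr>"

text \<open>\<open>runs c s t s'\<close>: started in \<open>s\<close>, the program \<open>c\<close> terminates in \<open>s'\<close> after
  \<open>t\<close> units of time.\<close>

inductive runs :: "com \<Rightarrow> state \<Rightarrow> nat \<Rightarrow> state \<Rightarrow> bool" where
  Skip: "runs Skip s 1 s"
| NStore: "runs (NStore x i a) s (ncost i + ncost a + 1) (nstore x (nval i s) (nval a s) s)"
| RStore: "runs (RStore x i a) s (ncost i + rcost a + 1) (rstore x (nval i s) (rval a s) s)"
| Seq: "runs c1 s1 t1 s2 \<Longrightarrow> runs c2 s2 t2 s3 \<Longrightarrow> runs (Seq c1 c2) s1 (t1 + t2) s3"
| CondTrue: "bval b s \<Longrightarrow> runs c1 s t s' \<Longrightarrow> runs (Cond b c1 c2) s (bcost b + t + 1) s'"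
| CondFalse: "\<not> bval b s \<Longrightarrow> runs c2 s t s' \<Longrightarrow> runs (Cond b c1 c2) s (bcost b + t + 1) s'"
| LoopFalse: "\<not> bval b s \<Longrightarrow> runs (Loop b c) s (bcost b + 1) s"
| LoopTrue: "bval b s1 \<Longrightarrow> runs c s1 t1 s2 \<Longrightarrow> runs (Loop b c) s2 t2 s3 \<Longrightarrow>
    runs (Loop b c) s1 (bcost b + 1 + t1 + t2) s3"

inductive_cases runs_SkipE: "runs Skip s t s'"
inductive_cases runs_NStoreE: "runs (NStore x i a) s t s'"
inductive_cases runs_RStoreE: "runs (RStore x i a) s t s'"
inductive_cases runs_SeqE: "runs (Seq c1 c2) s t s'"
inductive_cases runs_CondE: "runs (Cond b c1 c2) s t s'"
inductive_cases runs_LoopE: "runs (Loop b c) s t s'"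

lemma runs_deterministic:
  "runs c s t s' \<Longrightarrow> runs c s u s'' \<Longrightarrow> u = t \<and> s'' = s'"
proof (induction arbitrary: u s'' rule: runs.induct)
  case Skip then show ?case by (auto elim: runs_SkipE)
next
  case NStore then show ?case by (auto elim: runs_NStoreE)
next
  case RStore then show ?case by (auto elim: runs_RStoreE)
next
  case (Seq c1 s1 t1 s2 c2 t2 s3)
  from Seq.prems obtain t1' s2' t2'
    where "runs c1 s1 t1' s2'" "runs c2 s2' t2' s''" "u = t1' + t2'"
    by (auto elim: runs_SeqE)
  with Seq.IH show ?case by blast
next
  case (CondTrue b s c1 t s' c2)
  from CondTrue.prems CondTrue.hyps(1) obtain t' where "runs c1 s t' s''" "u = bcost b + t' + 1"
    by (auto elim: runs_CondE)
  with CondTrue.IH show ?case by blast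
next
  case (CondFalse b s c2 t s' c1)
  from CondFalse.prems CondFalse.hyps(1) obtain t' where "runs c2 s t' s''" "u = bcost b + t' + 1"
    by (auto elim: runs_CondE)
  with CondFalse.IH show ?case by blast
next
  case LoopFalse then show ?case by (auto elim: runs_LoopE)
next
  case (LoopTrue b s1 c t1 s2 t2 s3)
  from LoopTrue.prems LoopTrue.hyps(1) obtain t1' s2' t2'
    where "runs c s1 t1' s2'" "runs (Loop b c) s2' t2' s''" "u = bcost b + 1 + t1' + t2'"
    by (auto elim: runs_LoopE)
  with LoopTrue.IH show ?case by blast
qed

text \<open>The input is a point set, given by an enumeration of its points: their number in
  \<open>n\<close>, their coordinates in the arrays \<open>x\<close> and \<open>y\<close>.  All other memory is initially zero.\<close>

definition input_state :: "(real^2) list \<Rightarrow> state" where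
  "input_state ps =
     \<lparr>nats = (\<lambda>v i. if v = ''n'' \<and> i = 0 then length ps else 0),
      reals = (\<lambda>v i. if i < length ps
        then (if v = ''x'' then ps ! i $ 1 else if v = ''y'' then ps ! i $ 2 else 0) else 0)\<rparr>"

text \<open>A program answers a yes/no question by storing 1 for yes in a designated scalar.\<close>

definition answers_yes :: "string \<Rightarrow> state \<Rightarrow> bool" where
  "answers_yes v s \<longleftrightarrow> nats s v 0 = 1"

end

theory Submission
  imports Defs
begin

text \<open>Let \<open>v\<close> be the sum of the unit vectors from a point \<open>p\<close> of \<open>T\<close> to the points of \<open>T\<close>.  This one vector
answers both questions about \<open>p\<close>.

Membership.  The rays from a point \<open>p\<close> of a circle to the other points of the circle fill exactly the
open halfplane of directions around the axis from \<open>p\<close> to the center, one point per ray.  So \<open>T\<close>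
extends a reflection symmetric set with pivot \<open>p\<close> iff the directions from \<open>p\<close> to the rest of \<open>T\<close> are
distinct, lie in an open halfplane around some axis, avoid the axis, and are symmetric about it.
The axis need not be searched for: a symmetric family of unit vectors sums to a vector on its
axis of symmetry, so the axis is spanned by \<open>v\<close>.  Relative to \<open>v\<close>, a direction in the halfplane is
described by one real number, the tangent of its angle with \<open>v\<close>, here called its slope.  With slope
0 assigned to \<open>p\<close> itself, the condition is that all directions have positive inner product with \<open>v\<close>
and that the slopes of all points of \<open>T\<close> are distinct and closed under negation
(\<open>pivot_if_extension\<close>, \<open>extension_if_pivot\<close>).  After sorting, closure is a comparison of each
position with its mirror position (\<open>strictly_sorted_and_odd_iff\<close>), so one candidate costs
\<open>O(k log k)\<close> with merge sort (\<open>check_candidate_correct\<close>).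

Fermat-Weber point.  At a point of \<open>T\<close>, the sum of distances has the one-sided directional
derivative \<open>norm w - v \<bullet> w\<close> in direction \<open>w\<close>; by convexity \<open>p\<close> is a minimizer iff \<open>norm v \<le> 1\<close>
(\<open>fermat_weber_point_iff\<close>).

Candidates.  A pivot is the unique minimizer over \<open>T\<close> of the linear function with gradient \<open>v\<close>.  If
the second coordinate of \<open>v\<close> is nonnegative, it lies on the lower hull, which gift wrapping
traverses from the lexicographically least to the greatest point; the other pivots are found by
the same walk after all coordinates are negated.  Each point visited strictly between the
two ends of a walk lies between two edges of the hull, hence is a vertex, so at most \<open>h + 2\<close> candidates are checked in each walk
(\<open>walk_lower_hull_correct\<close>).

The time bounds carry explicit constants, chosen with ample slack.\<close>

section \<open>Timed reasoning about programs\<close>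

fun loop_free :: "com \<Rightarrow> bool" where
  "loop_free (Seq c1 c2) \<longleftrightarrow> loop_free c1 \<and> loop_free c2"
| "loop_free (Cond b c1 c2) \<longleftrightarrow> loop_free c1 \<and> loop_free c2"
| "loop_free (Loop b c) \<longleftrightarrow> False"
| "loop_free _ \<longleftrightarrow> True"

fun exec :: "com \<Rightarrow> state \<Rightarrow> state" where
  "exec Skip s = s"
| "exec (NStore x i a) s = nstore x (nval i s) (nval a s) s"
| "exec (RStore x i a) s = rstore x (nval i s) (rval a s) s"
| "exec (Seq c1 c2) s = exec c2 (exec c1 s)"
| "exec (Cond b c1 c2) s = (if bval b s then exec c1 s else exec c2 s)"
| "exec (Loop b c) s = s"

fun worst_cost :: "com \<Rightarrow> nat" where
  "worst_cost Skip = 1"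
| "worst_cost (NStore x i a) = ncost i + ncost a + 1"
| "worst_cost (RStore x i a) = ncost i + rcost a + 1"
| "worst_cost (Seq c1 c2) = worst_cost c1 + worst_cost c2"
| "worst_cost (Cond b c1 c2) = bcost b + max (worst_cost c1) (worst_cost c2) + 1"
| "worst_cost (Loop b c) = 0"

text \<open>Programs without loops are evaluated symbolically by the simplifier; only loops need invariants.\<close>

lemma runs_exec: "loop_free c \<Longrightarrow> \<exists>t \<le> worst_cost c. runs c s t (exec c s)"
proof (induction c arbitrary: s)
  case (Seq c1 c2)
  then obtain t1 t2 where "t1 \<le> worst_cost c1" "runs c1 s t1 (exec c1 s)"
    "t2 \<le> worst_cost c2" "runs c2 (exec c1 s) t2 (exec c2 (exec c1 s))"
    by (meson loop_free.simps(1))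
  then show ?case by (auto intro!: exI[of _ "t1 + t2"] runs.Seq)
next
  case (Cond b c1 c2)
  then obtain t1 t2 where *: "t1 \<le> worst_cost c1" "runs c1 s t1 (exec c1 s)"
    "t2 \<le> worst_cost c2" "runs c2 s t2 (exec c2 s)"
    by (meson loop_free.simps(2))
  show ?case
  proof (cases "bval b s")
    case True
    with * show ?thesis by (auto intro!: exI[of _ "bcost b + t1 + 1"] runs.CondTrue)
  next
    case False
    with * show ?thesis by (auto intro!: exI[of _ "bcost b + t2 + 1"] runs.CondFalse)
  qed
next
  case (Loop b c)
  then show ?case by simp
qed (unfold worst_cost.simps exec.simps, (rule exI, rule conjI, rule order_refl, rule runs.intros)+)

fun nmods :: "com \<Rightarrow> string set" where
  "nmods (NStore x i a) = {x}"
| "nmods (Seq c1 c2) = nmods c1 \<union> nmods c2"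
| "nmods (Cond b c1 c2) = nmods c1 \<union> nmods c2"
| "nmods (Loop b c) = nmods c"
| "nmods _ = {}"

fun rmods :: "com \<Rightarrow> string set" where
  "rmods (RStore x i a) = {x}"
| "rmods (Seq c1 c2) = rmods c1 \<union> rmods c2"
| "rmods (Cond b c1 c2) = rmods c1 \<union> rmods c2"
| "rmods (Loop b c) = rmods c"
| "rmods _ = {}"

definition frame :: "com \<Rightarrow> state \<Rightarrow> state \<Rightarrow> bool" where
  "frame c s s' \<longleftrightarrow> (\<forall>x. x \<notin> nmods c \<longrightarrow> nats s' x = nats s x) \<and>
                  (\<forall>x. x \<notin> rmods c \<longrightarrow> reals s' x = reals s x)"

lemma frameD:
  assumes "frame c s s'"
  shows "x \<notin> nmods c \<Longrightarrow> nats s' x = nats s x" "y \<notin> rmods c \<Longrightarrow> reals s' y = reals s y"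
  using assms by (auto simp: frame_def)

lemma frame_refl: "frame c s s"
  by (simp add: frame_def)

lemma nats_nstore [simp]: "nats (nstore x i v s) = (nats s)(x := (nats s x)(i := v))"
  and reals_nstore [simp]: "reals (nstore x i v s) = reals s"
  and nats_rstore [simp]: "nats (rstore x i r s) = nats s"
  and reals_rstore [simp]: "reals (rstore x i r s) = (reals s)(x := (reals s x)(i := r))"
  by (simp_all add: nstore_def rstore_def)

text \<open>Together with \<open>nmods\<close> and \<open>rmods\<close>, this makes it unnecessary to state in specifications and
invariants what a program leaves unchanged.\<close>

lemma runs_frame: "runs c s t s' \<Longrightarrow> frame c s s'"
  by (induction rule: runs.induct) (auto simp: frame_def)

definition achieves :: "com \<Rightarrow> state \<Rightarrow> nat \<Rightarrow> (state \<Rightarrow> bool) \<Rightarrow> bool" where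
  "achieves c s B Q \<longleftrightarrow> (\<exists>t s'. runs c s t s' \<and> t \<le> B \<and> Q s')"

lemma achieves_mono:
  assumes "achieves c s B Q" "B \<le> B'" "\<And>s'. Q s' \<Longrightarrow> frame c s s' \<Longrightarrow> Q' s'"
  shows "achieves c s B' Q'"
  using assms runs_frame unfolding achieves_def by (meson le_trans)

lemma achieves_exec:
  "loop_free c \<Longrightarrow> worst_cost c \<le> B \<Longrightarrow> Q (exec c s) \<Longrightarrow> achieves c s B Q"
  using runs_exec[of c s] unfolding achieves_def by (meson le_trans)

lemma achieves_Seq:
  assumes "achieves c1 s B1 Q" "\<And>s'. Q s' \<Longrightarrow> frame c1 s s' \<Longrightarrow> achieves c2 s' B2 R" "B1 + B2 \<le> B"
  shows "achieves (Seq c1 c2) s B R"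
proof -
  obtain t1 s1 where 1: "runs c1 s t1 s1" "t1 \<le> B1" "Q s1"
    using assms(1) unfolding achieves_def by blast
  then obtain t2 s2 where "runs c2 s1 t2 s2" "t2 \<le> B2" "R s2"
    using assms(2) runs_frame unfolding achieves_def by blast
  with 1 assms(3) show ?thesis
    unfolding achieves_def by (auto intro!: exI[of _ "t1 + t2"] exI[of _ s2] runs.Seq)
qed

lemma achieves_Seq_exec:
  "loop_free c1 \<Longrightarrow> achieves c2 (exec c1 s) B2 R \<Longrightarrow> worst_cost c1 + B2 \<le> B \<Longrightarrow>
    achieves (Seq c1 c2) s B R"
  by (rule achieves_Seq[where Q = "\<lambda>s'. s' = exec c1 s", OF achieves_exec]) auto

text \<open>The invariant carries a bound \<open>j\<close> on the number of iterations that remain.  Because the bound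
  need not be a function of the state, the same rule covers counting loops, loops that double a
  variable, and a walk along a chain whose length is only known in terms of the input's geometry.
  Everything the body does not assign to keeps its initial value; the rule supplies this.\<close>

lemma achieves_Loop:
  assumes step: "\<And>j s'. I j s' \<Longrightarrow> frame c s s' \<Longrightarrow> bval b s' \<Longrightarrow>
      achieves c s' B (\<lambda>s''. \<exists>j'<j. I j' s'')"
    and init: "I N s"
    and final: "\<And>j s'. I j s' \<Longrightarrow> frame c s s' \<Longrightarrow> \<not> bval b s' \<Longrightarrow> Q s'"
    and cost: "N * (B + bcost b + 1) + bcost b + 1 \<le> B'"
  shows "achieves (Loop b c) s B' Q"
proof -
  have "achieves (Loop b c) s' (N * (B + bcost b + 1) + bcost b + 1) Q"
    if "I N s'" "frame c s s'" for s'
    using that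
  proof (induction N arbitrary: s' rule: less_induct)
    case (less N)
    show ?case
    proof (cases "bval b s'")
      case False
      with less.prems final show ?thesis
        unfolding achieves_def by (auto intro!: exI[of _ "bcost b + 1"] exI[of _ s'] runs.LoopFalse)
    next
      case True
      obtain t1 s1 N' where 1: "runs c s' t1 s1" "t1 \<le> B" "N' < N" "I N' s1"
        using step[OF less.prems True] unfolding achieves_def by blast
      have "frame c s s1"
        using runs_frame[OF 1(1)] less.prems(2) by (simp add: frame_def)
      from less.IH[OF 1(3,4) this] obtain t2 s2 where
        2: "runs (Loop b c) s1 t2 s2" "t2 \<le> N' * (B + bcost b + 1) + bcost b + 1" "Q s2"
        unfolding achieves_def by blast
      have "Suc N' * (B + bcost b + 1) \<le> N * (B + bcost b + 1)"
        using 1(3) by (intro mult_right_mono) auto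
      then have "bcost b + 1 + t1 + t2 \<le> N * (B + bcost b + 1) + bcost b + 1"
        using 1(2) 2(2) by simp
      then show ?thesis
        using runs.LoopTrue[OF True 1(1) 2(1)] 2(3) unfolding achieves_def by blast
    qed
  qed
  from achieves_mono[OF this[OF init frame_refl] cost] show ?thesis by simp
qed

abbreviation NVar :: "string \<Rightarrow> nexp" where "NVar x \<equiv> NLoad x (NConst 0)"
abbreviation RVar :: "string \<Rightarrow> rexp" where "RVar x \<equiv> RLoad x (NConst 0)"
abbreviation NSet :: "string \<Rightarrow> nexp \<Rightarrow> com" where "NSet x \<equiv> NStore x (NConst 0)"
abbreviation RSet :: "string \<Rightarrow> rexp \<Rightarrow> com" where "RSet x \<equiv> RStore x (NConst 0)"

definition for_all_inputs :: "com \<Rightarrow> com" where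
  "for_all_inputs c = Seq (NSet ''i'' (NConst 0)) (Loop (NLess (NVar ''i'') (NVar ''n''))
     (Seq c (NSet ''i'' (NAdd (NVar ''i'') (NConst 1)))))"

lemma mods_for_all_inputs [simp]:
  "nmods (for_all_inputs c) = insert ''i'' (nmods c)" "rmods (for_all_inputs c) = rmods c"
  by (auto simp: for_all_inputs_def)

lemma achieves_for_all_inputs:
  assumes c: "loop_free c" "''i'' \<notin> nmods c" "''n'' \<notin> nmods c"
    and n: "nats s ''n'' 0 = n"
    and init: "I 0 (nstore ''i'' 0 0 s)"
    and step: "\<And>i s'. \<lbrakk> I i s'; i < n; nats s' ''i'' 0 = i; nats s' ''n'' 0 = n;
        frame (for_all_inputs c) s s' \<rbrakk> \<Longrightarrow> I (Suc i) (nstore ''i'' 0 (Suc i) (exec c s'))"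
    and final: "\<And>s'. I n s' \<Longrightarrow> frame (for_all_inputs c) s s' \<Longrightarrow> Q s'"
    and cost: "n * (worst_cost c + 12) + 9 \<le> B"
  shows "achieves (for_all_inputs c) s B Q"
proof -
  let ?c = "Seq c (NSet ''i'' (NAdd (NVar ''i'') (NConst 1)))"
  let ?s = "nstore ''i'' 0 0 s"
  define J where "J j s' \<longleftrightarrow> (\<exists>i\<le>n. j = n - i \<and> nats s' ''i'' 0 = i \<and> nats s' ''n'' 0 = n \<and> I i s')"
    for j s'
  have exec_keeps: "nats (exec c s') x = nats s' x" if "x \<notin> nmods c" for s' x
    using runs_exec[OF c(1), of s'] runs_frame frameD(1)[OF _ that] by metis
  have fr: "frame (for_all_inputs c) s s'" if "frame ?c ?s s'" for s'
    using that by (simp add: frame_def)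
  have "achieves (Loop (NLess (NVar ''i'') (NVar ''n'')) ?c) ?s (n * (worst_cost c + 12) + 6) Q"
  proof (rule achieves_Loop[where I = J and N = n and B = "worst_cost c + 6"])
    show "J n ?s" using init n by (auto simp: J_def)
  next
    fix j s' assume "J j s'" "frame ?c ?s s'" "bval (NLess (NVar ''i'') (NVar ''n'')) s'"
    then show "achieves ?c s' (worst_cost c + 6) (\<lambda>s''. \<exists>j'<j. J j' s'')"
      using step c fr by (intro achieves_exec) (auto simp: J_def exec_keeps)
  next
    fix j s' assume "J j s'" "frame ?c ?s s'" "\<not> bval (NLess (NVar ''i'') (NVar ''n'')) s'"
    then show "Q s'" using final fr by (auto simp: J_def)
  qed simp
  then show ?thesis
    unfolding for_all_inputs_def
    by (intro achieves_Seq[where Q = "\<lambda>s'. s' = ?s" and ?B1.0 = 3, OF achieves_exec])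
       (use cost in auto)
qed

section \<open>Merge sort\<close>

text \<open>Runs of length \<open>w\<close> occupy the index ranges on which \<open>i div w\<close> is constant.\<close>

definition sorted_runs :: "nat \<Rightarrow> nat \<Rightarrow> (nat \<Rightarrow> real) \<Rightarrow> bool" where
  "sorted_runs w n a \<longleftrightarrow> (\<forall>i j. i \<le> j \<and> j < n \<and> i div w = j div w \<longrightarrow> a i \<le> a j)"

text \<open>Merging \<open>a\<close> on \<open>{b..<m}\<close> with \<open>a\<close> on \<open>{m..<e}\<close>: \<open>l\<close> and \<open>r\<close> are the read positions, and the write
  position is \<open>l + r - m\<close>.  Sets of values suffice in place of multisets: in the end \<open>n\<close> cells are
  tested for being strictly increasing, and \<open>n\<close> cells holding a set of \<open>n\<close> values hold each of
  them once.\<close>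

definition merging ::
  "(nat \<Rightarrow> real) \<Rightarrow> nat \<Rightarrow> nat \<Rightarrow> nat \<Rightarrow> nat \<Rightarrow> nat \<Rightarrow> (nat \<Rightarrow> real) \<Rightarrow> bool" where
  "merging a b m e l r t \<longleftrightarrow> b \<le> l \<and> l \<le> m \<and> m \<le> r \<and> r \<le> e \<and>
     t ` {b..<l + r - m} = a ` ({b..<l} \<union> {m..<r}) \<and> mono_on {b..<l + r - m} t \<and>
     (\<forall>p\<in>{b..<l + r - m}. \<forall>q\<in>{l..<m} \<union> {r..<e}. t p \<le> a q)"

text \<open>Both cases of a merge step append a value that is at least everything written so far.\<close>

lemma merging_append:
  assumes t: "mono_on {b..<p::nat} (t :: nat \<Rightarrow> real)" and v: "\<forall>i\<in>{b..<p}. t i \<le> v" and "b \<le> p"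
  shows "mono_on {b..<Suc p} (t(p := v))" "(t(p := v)) ` {b..<Suc p} = insert v (t ` {b..<p})"
proof -
  show "mono_on {b..<Suc p} (t(p := v))"
    using v by (auto simp: less_Suc_eq intro!: mono_onI mono_onD[OF t])
  have "{b..<Suc p} = insert p {b..<p}" using \<open>b \<le> p\<close> by auto
  then show "(t(p := v)) ` {b..<Suc p} = insert v (t ` {b..<p})" by (auto simp: image_iff)
qed

lemma merging_left:
  assumes M: "merging a b m e l r t" and l: "l < m" and r: "r < e \<longrightarrow> a l \<le> a r"
    and a: "mono_on {b..<m} a" "mono_on {m..<e} a"
  shows "merging a b m e (Suc l) r (t(l + r - m := a l))"
proof -
  have o: "Suc l + r - m = Suc (l + r - m)" "b \<le> l + r - m"
    using M l by (auto simp: merging_def)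
  have bl: "{b..<Suc l} = insert l {b..<l}" using M by (auto simp: merging_def)
  have le: "a l \<le> a q" if "q \<in> {Suc l..<m} \<union> {r..<e}" for q
  proof (cases "q < m")
    case True
    then show ?thesis using that M l
      by (intro mono_onD[OF a(1)]) (auto simp: merging_def)
  next
    case False
    then have "a r \<le> a q" using that M by (intro mono_onD[OF a(2)]) (auto simp: merging_def)
    then show ?thesis using that False r by auto
  qed
  have "\<forall>i\<in>{b..<l + r - m}. t i \<le> a l" using M l by (auto simp: merging_def)
  note app = merging_append[OF _ this o(2)]
  show ?thesis
    using M l app le unfolding merging_def o(1) by (auto simp: bl less_Suc_eq)
qed

lemma merging_right:
  assumes M: "merging a b m e l r t" and r: "r < e" and l: "l < m \<longrightarrow> a r \<le> a l"
    and a: "mono_on {b..<m} a" "mono_on {m..<e} a"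
  shows "merging a b m e l (Suc r) (t(l + r - m := a r))"
proof -
  have o: "l + Suc r - m = Suc (l + r - m)" "b \<le> l + r - m"
    using M by (auto simp: merging_def)
  have bl: "{m..<Suc r} = insert r {m..<r}" using M by (auto simp: merging_def)
  have le: "a r \<le> a q" if "q \<in> {l..<m} \<union> {Suc r..<e}" for q
  proof (cases "q < m")
    case True
    then have "a l \<le> a q" using that M by (intro mono_onD[OF a(1)]) (auto simp: merging_def)
    then show ?thesis using that True l M by (auto simp: merging_def)
  next
    case False
    then show ?thesis using that M r by (intro mono_onD[OF a(2)]) (auto simp: merging_def)
  qed
  have "\<forall>i\<in>{b..<l + r - m}. t i \<le> a r" using M r by (auto simp: merging_def)
  note app = merging_append[OF _ this o(2)]
  show ?thesis
    using M r app le unfolding merging_def o(1) by (auto simp: bl less_Suc_eq)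
qed

definition merge_element :: com where
  "merge_element = Seq
     (Cond (BAnd (NLess (NVar ''l'') (NVar ''m''))
             (BNot (BAnd (NLess (NVar ''r'') (NVar ''e''))
                (RLess (RLoad ''a'' (NVar ''r'')) (RLoad ''a'' (NVar ''l''))))))
       (Seq (RStore ''t'' (NVar ''o'') (RLoad ''a'' (NVar ''l'')))
            (NSet ''l'' (NAdd (NVar ''l'') (NConst 1))))
       (Seq (RStore ''t'' (NVar ''o'') (RLoad ''a'' (NVar ''r'')))
            (NSet ''r'' (NAdd (NVar ''r'') (NConst 1)))))
     (NSet ''o'' (NAdd (NVar ''o'') (NConst 1)))"

text \<open>Truncated subtraction yields minima: \<open>x - (x - y) = min x y\<close>.\<close>

definition merge_setup :: com where
  "merge_setup =
    Seq (NSet ''m'' (NAdd (NVar ''b'') (NVar ''w'')))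
   (Seq (NSet ''e'' (NAdd (NVar ''m'') (NVar ''w'')))
   (Seq (NSet ''m'' (NSub (NVar ''m'') (NSub (NVar ''m'') (NVar ''n''))))
   (Seq (NSet ''e'' (NSub (NVar ''e'') (NSub (NVar ''e'') (NVar ''n''))))
   (Seq (NSet ''l'' (NVar ''b''))
   (Seq (NSet ''r'' (NVar ''m''))
        (NSet ''o'' (NVar ''b'')))))))"

definition merge_two_runs :: com where
  "merge_two_runs = Seq merge_setup
     (Seq (Loop (NLess (NVar ''o'') (NVar ''e'')) merge_element)
          (NSet ''b'' (NAdd (NAdd (NVar ''b'') (NVar ''w'')) (NVar ''w''))))"

definition merge_pass :: com where
  "merge_pass = Seq (NSet ''b'' (NConst 0))
     (Seq (Loop (NLess (NVar ''b'') (NVar ''n'')) merge_two_runs)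
          (for_all_inputs (RStore ''a'' (NVar ''i'') (RLoad ''t'' (NVar ''i'')))))"

definition merge_sort :: com where
  "merge_sort = Seq (NSet ''w'' (NConst 1))
     (Loop (NLess (NVar ''w'') (NVar ''n''))
        (Seq merge_pass (NSet ''w'' (NAdd (NVar ''w'') (NVar ''w'')))))"

lemma mods_merge_element [simp]:
  "nmods merge_element = {''l'', ''r'', ''o''}" "rmods merge_element = {''t''}"
  by (auto simp: merge_element_def)

lemma mods_merge_two_runs [simp]:
  "nmods merge_two_runs = {''m'', ''e'', ''l'', ''r'', ''o'', ''b''}" "rmods merge_two_runs = {''t''}"
  by (auto simp: merge_two_runs_def merge_setup_def)

lemma mods_merge_pass [simp]:
  "nmods merge_pass = {''m'', ''e'', ''l'', ''r'', ''o'', ''b'', ''i''}"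
  "rmods merge_pass = {''t'', ''a''}"
  by (auto simp: merge_pass_def)

lemma mods_merge_sort [simp]:
  "nmods merge_sort = {''m'', ''e'', ''l'', ''r'', ''o'', ''b'', ''i'', ''w''}"
  "rmods merge_sort = {''t'', ''a''}"
  by (auto simp: merge_sort_def)

lemma merge_loop:
  assumes "merging a b m e b m t0" and a: "mono_on {b..<m} a" "mono_on {m..<e} a"
    and s: "reals s ''a'' = a" "reals s ''t'' = t0" "nats s ''l'' 0 = b" "nats s ''r'' 0 = m"
      "nats s ''o'' 0 = b" "nats s ''m'' 0 = m" "nats s ''e'' 0 = e"
  shows "achieves (Loop (NLess (NVar ''o'') (NVar ''e'')) merge_element) s ((e - b) * 50 + 6)
     (\<lambda>s'. merging a b m e m e (reals s' ''t'') \<and> (\<forall>i<b. reals s' ''t'' i = t0 i))"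
proof (rule achieves_Loop[where N = "e - b" and B = 44 and
    I = "\<lambda>j s'. \<exists>l r. nats s' ''l'' 0 = l \<and> nats s' ''r'' 0 = r \<and> nats s' ''o'' 0 = l + r - m \<and>
       j = e - (l + r - m) \<and> merging a b m e l r (reals s' ''t'') \<and> (\<forall>i<b. reals s' ''t'' i = t0 i)"])
  show "\<exists>l r. nats s ''l'' 0 = l \<and> nats s ''r'' 0 = r \<and> nats s ''o'' 0 = l + r - m \<and>
       e - b = e - (l + r - m) \<and> merging a b m e l r (reals s ''t'') \<and> (\<forall>i<b. reals s ''t'' i = t0 i)"
    using assms by auto
next
  fix j s'
  assume I: "\<exists>l r. nats s' ''l'' 0 = l \<and> nats s' ''r'' 0 = r \<and> nats s' ''o'' 0 = l + r - m \<and>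
       j = e - (l + r - m) \<and> merging a b m e l r (reals s' ''t'') \<and> (\<forall>i<b. reals s' ''t'' i = t0 i)"
    and fr: "frame merge_element s s'" and "bval (NLess (NVar ''o'') (NVar ''e'')) s'"
  then obtain l r where v: "nats s' ''l'' 0 = l" "nats s' ''r'' 0 = r" "nats s' ''o'' 0 = l + r - m"
    "j = e - (l + r - m)" and M: "merging a b m e l r (reals s' ''t'')"
    and keep: "\<forall>i<b. reals s' ''t'' i = t0 i" by blast
  note f = frameD[OF fr, simplified]
  have f': "nats s' ''m'' 0 = m" "nats s' ''e'' 0 = e" "reals s' ''a'' = a"
    using f s by auto
  have less: "l + r - m < e" using \<open>bval _ _\<close> v f' by simp
  have ord: "b \<le> l" "l \<le> m" "m \<le> r" "r \<le> e" using M by (auto simp: merging_def)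
  show "achieves merge_element s' 44 (\<lambda>s'. \<exists>j'<j. \<exists>l r. nats s' ''l'' 0 = l \<and> nats s' ''r'' 0 = r \<and>
       nats s' ''o'' 0 = l + r - m \<and> j' = e - (l + r - m) \<and> merging a b m e l r (reals s' ''t'') \<and>
       (\<forall>i<b. reals s' ''t'' i = t0 i))"
  proof (cases "l < m \<and> \<not> (r < e \<and> a r < a l)")
    case True
    then have "merging a b m e (Suc l) r ((reals s' ''t'')(l + r - m := a l))"
      using merging_left[OF M _ _ a] by auto
    then show ?thesis
      using True v f' keep less ord
      by (intro achieves_exec) (auto simp: merge_element_def Suc_diff_le)
  next
    case False
    then have "r < e" using less ord by auto
    then have "merging a b m e l (Suc r) ((reals s' ''t'')(l + r - m := a r))"
      using False merging_right[OF M _ _ a] by auto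
    then show ?thesis
      using False v f' keep less ord
      by (intro achieves_exec) (auto simp: merge_element_def Suc_diff_le)
  qed
next
  fix j s'
  assume I: "\<exists>l r. nats s' ''l'' 0 = l \<and> nats s' ''r'' 0 = r \<and> nats s' ''o'' 0 = l + r - m \<and>
       j = e - (l + r - m) \<and> merging a b m e l r (reals s' ''t'') \<and> (\<forall>i<b. reals s' ''t'' i = t0 i)"
    and fr: "frame merge_element s s'" and "\<not> bval (NLess (NVar ''o'') (NVar ''e'')) s'"
  then obtain l r where o: "nats s' ''o'' 0 = l + r - m" and M: "merging a b m e l r (reals s' ''t'')"
    and keep: "\<forall>i<b. reals s' ''t'' i = t0 i"
    by blast
  have "nats s' ''e'' 0 = e" using frameD[OF fr, simplified] s by simp
  with o \<open>\<not> bval _ _\<close> have "e \<le> l + r - m" by simp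
  with M have "l = m" "r = e" by (auto simp: merging_def)
  with M keep show "merging a b m e m e (reals s' ''t'') \<and> (\<forall>i<b. reals s' ''t'' i = t0 i)" by simp
qed simp

lemma merge_two_runs_correct:
  assumes b: "b = q * (2 * w)" "b < n" and "w > 0" and a: "sorted_runs w n a"
    and t: "t0 ` {..<b} = a ` {..<b}" "sorted_runs (2 * w) b t0"
    and s: "reals s ''a'' = a" "reals s ''t'' = t0" "nats s ''b'' 0 = b" "nats s ''w'' 0 = w"
      "nats s ''n'' 0 = n"
  defines "e \<equiv> min (b + 2 * w) n"
  shows "achieves merge_two_runs s (100 * w + 70)
     (\<lambda>s'. nats s' ''b'' 0 = b + 2 * w \<and> reals s' ''t'' ` {..<e} = a ` {..<e} \<and>
           sorted_runs (2 * w) e (reals s' ''t''))"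
proof -
  define m where "m = min (b + w) n"
  have ord: "b \<le> m" "m \<le> e" "e \<le> n" "e - b \<le> 2 * w" "b < e"
    using b \<open>w > 0\<close> by (auto simp: m_def e_def)
  have left: "mono_on {b..<m} a"
  proof (rule mono_onI)
    fix i j assume "i \<in> {b..<m}" "j \<in> {b..<m}" "i \<le> j"
    moreover from this have "i div w = 2 * q" "j div w = 2 * q"
      by (auto simp: b m_def algebra_simps intro!: div_nat_eqI)
    ultimately show "a i \<le> a j" using a ord by (auto simp: sorted_runs_def)
  qed
  have right: "mono_on {m..<e} a"
  proof (rule mono_onI)
    fix i j assume "i \<in> {m..<e}" "j \<in> {m..<e}" "i \<le> j"
    moreover from this have "i div w = 2 * q + 1" "j div w = 2 * q + 1"
      by (auto simp: b m_def e_def algebra_simps intro!: div_nat_eqI)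
    ultimately show "a i \<le> a j" using a ord by (auto simp: sorted_runs_def)
  qed
  let ?s = "exec merge_setup s"
  have set: "reals ?s = reals s" "nats ?s ''l'' 0 = b" "nats ?s ''r'' 0 = m" "nats ?s ''o'' 0 = b"
    "nats ?s ''m'' 0 = m" "nats ?s ''e'' 0 = e" "nats ?s ''b'' 0 = b" "nats ?s ''w'' 0 = w"
    using s by (auto simp: merge_setup_def m_def e_def)
  have start: "merging a b m e b m t0"
    using ord by (auto simp: merging_def monotone_on_def)
  let ?done = "\<lambda>t. merging a b m e m e t \<and> (\<forall>i<b. t i = t0 i)"
  have result: "t ` {..<e} = a ` {..<e}" "sorted_runs (2 * w) e t" if "?done t" for t
  proof -
    have e: "{..<e} = {..<b} \<union> {b..<e}" "{b..<e} = {b..<m} \<union> {m..<e}" using ord by auto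
    have te: "t ` {b..<e} = a ` {b..<e}" "mono_on {b..<e} t"
      using that ord e(2) by (auto simp: merging_def)
    have "t ` {..<b} = t0 ` {..<b}" using that by (intro image_cong) auto
    with te t show "t ` {..<e} = a ` {..<e}" unfolding e(1) image_Un by simp
    show "sorted_runs (2 * w) e t"
      unfolding sorted_runs_def
    proof (intro allI impI)
      fix i j assume ij: "i \<le> j \<and> j < e \<and> i div (2 * w) = j div (2 * w)"
      show "t i \<le> t j"
      proof (cases "j < b")
        case True
        with ij that t(2) show ?thesis by (auto simp: sorted_runs_def)
      next
        case False
        then have "j div (2 * w) = q"
          using ij by (intro div_nat_eqI) (auto simp: b e_def algebra_simps)
        then have "b \<le> i" using ij b by (metis div_times_less_eq_dividend)
        then show ?thesis using ij False te(2) by (auto intro!: mono_onD[OF te(2)])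
      qed
    qed
  qed
  show ?thesis
    unfolding merge_two_runs_def
  proof (rule achieves_Seq[where Q = "\<lambda>s'. s' = ?s" and ?B1.0 = 46])
    show "achieves merge_setup s 46 (\<lambda>s'. s' = ?s)"
      by (intro achieves_exec) (auto simp: merge_setup_def)
    fix s' assume s': "s' = ?s"
    show "achieves (Seq (Loop (NLess (NVar ''o'') (NVar ''e'')) merge_element)
         (NSet ''b'' (NAdd (NAdd (NVar ''b'') (NVar ''w'')) (NVar ''w'')))) s' ((e - b) * 50 + 18)
       (\<lambda>s'. nats s' ''b'' 0 = b + 2 * w \<and> reals s' ''t'' ` {..<e} = a ` {..<e} \<and>
           sorted_runs (2 * w) e (reals s' ''t''))"
    proof (rule achieves_Seq[OF merge_loop[OF start left right]])
      fix s2 assume s2: "?done (reals s2 ''t'')"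
        and "frame (Loop (NLess (NVar ''o'') (NVar ''e'')) merge_element) s' s2"
      note f = frameD[OF this(2), simplified]
      show "achieves (NSet ''b'' (NAdd (NAdd (NVar ''b'') (NVar ''w'')) (NVar ''w''))) s2 12
         (\<lambda>s'. nats s' ''b'' 0 = b + 2 * w \<and> reals s' ''t'' ` {..<e} = a ` {..<e} \<and>
           sorted_runs (2 * w) e (reals s' ''t''))"
        using result[OF s2] f set s' by (intro achieves_exec) simp_all
    qed (use s' set s in auto)
  next
    show "46 + ((e - b) * 50 + 18) \<le> 100 * w + 70" using ord by simp
  qed
qed

lemma merge_pass_correct:
  assumes "0 < w" "w < n" and a: "sorted_runs w n a"
    and s: "reals s ''a'' = a" "nats s ''w'' 0 = w" "nats s ''n'' 0 = n"
  shows "achieves merge_pass s (600 * n + 30)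
     (\<lambda>s'. reals s' ''a'' ` {..<n} = a ` {..<n} \<and> sorted_runs (2 * w) n (reals s' ''a''))"
proof -
  \<comment> \<open>the number of blocks of length \<open>2 * w\<close>, rounded up; the factor 3 below is crude but suffices because \<open>w < n\<close>\<close>
  define N where "N = (n + 2 * w - 1) div (2 * w)"
  have N: "n \<le> N * (2 * w)" "N * (2 * w) \<le> 3 * n" 
  proof -
    have "n + 2 * w - 1 = N * (2 * w) + (n + 2 * w - 1) mod (2 * w)"
      unfolding N_def by (rule div_mult_mod_eq[symmetric])
    moreover have "(n + 2 * w - 1) mod (2 * w) < 2 * w" using assms(1) by simp
    ultimately show "n \<le> N * (2 * w)" "N * (2 * w) \<le> 3 * n" using assms(1,2) by linarith+
  qed
  \<comment> \<open>the last block may be cut off at \<open>n\<close>, hence the minima in the invariant\<close>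
  let ?merged = "\<lambda>s'. reals s' ''t'' ` {..<n} = a ` {..<n} \<and> sorted_runs (2 * w) n (reals s' ''t'')"
  define I where "I j s' \<longleftrightarrow> (\<exists>q. nats s' ''b'' 0 = q * (2 * w) \<and> n \<le> (q + j) * (2 * w) \<and>
      reals s' ''t'' ` {..<min (q * (2 * w)) n} = a ` {..<min (q * (2 * w)) n} \<and>
      sorted_runs (2 * w) (min (q * (2 * w)) n) (reals s' ''t''))" for j and s' :: state
  have loop: "achieves (Loop (NLess (NVar ''b'') (NVar ''n'')) merge_two_runs) s'
      (N * (100 * w + 76) + 6) ?merged"
    if s': "s' = exec (NSet ''b'' (NConst 0)) s" for s'
  proof (rule achieves_Loop[where I = I and N = N and B = "100 * w + 70"])
    show "I N s'" using N by (auto simp: I_def s' sorted_runs_def)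
  next
    fix j s1 assume "I j s1" "bval (NLess (NVar ''b'') (NVar ''n'')) s1"
      and fr: "frame merge_two_runs s' s1"
    note f = frameD[OF fr, simplified]
    obtain q where q: "nats s1 ''b'' 0 = q * (2 * w)" "n \<le> (q + j) * (2 * w)"
      "reals s1 ''t'' ` {..<min (q * (2 * w)) n} = a ` {..<min (q * (2 * w)) n}"
      "sorted_runs (2 * w) (min (q * (2 * w)) n) (reals s1 ''t'')"
      using \<open>I j s1\<close> by (auto simp: I_def)
    have less: "q * (2 * w) < n" using \<open>bval _ _\<close> q f s by (simp add: s')
    then have "(0 :: nat) < j" using q(2) by (cases j) auto
    have "achieves merge_two_runs s1 (100 * w + 70)
     (\<lambda>s'. nats s' ''b'' 0 = q * (2 * w) + 2 * w \<and>
        reals s' ''t'' ` {..<min (q * (2 * w) + 2 * w) n} = a ` {..<min (q * (2 * w) + 2 * w) n} \<and>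
        sorted_runs (2 * w) (min (q * (2 * w) + 2 * w) n) (reals s' ''t''))"
      using less q f s s' by (intro merge_two_runs_correct[OF refl less \<open>0 < w\<close> a]) auto
    then show "achieves merge_two_runs s1 (100 * w + 70) (\<lambda>s'. \<exists>j'<j. I j' s')"
    proof (rule achieves_mono[OF _ order_refl])
      fix s2 :: state
      assume "nats s2 ''b'' 0 = q * (2 * w) + 2 * w \<and>
        reals s2 ''t'' ` {..<min (q * (2 * w) + 2 * w) n} = a ` {..<min (q * (2 * w) + 2 * w) n} \<and>
        sorted_runs (2 * w) (min (q * (2 * w) + 2 * w) n) (reals s2 ''t'')"
      moreover have "q * (2 * w) + 2 * w = Suc q * (2 * w)" by simp
      moreover have "Suc q + (j - 1) = q + j" using \<open>0 < j\<close> by simp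
      ultimately have "I (j - 1) s2" using q(2) unfolding I_def by metis
      with \<open>0 < j\<close> show "\<exists>j'<j. I j' s2" by (intro exI[of _ "j - 1"]) simp
    qed
  next
    fix j s1 assume "I j s1" "\<not> bval (NLess (NVar ''b'') (NVar ''n'')) s1"
      and fr: "frame merge_two_runs s' s1"
    moreover have "nats s1 ''n'' 0 = n" using frameD[OF fr] s s' by simp
    ultimately obtain q where "n \<le> q * (2 * w)"
      "reals s1 ''t'' ` {..<min (q * (2 * w)) n} = a ` {..<min (q * (2 * w)) n}"
      "sorted_runs (2 * w) (min (q * (2 * w)) n) (reals s1 ''t'')"
      by (auto simp: I_def)
    then show "?merged s1" by (simp add: min_absorb2)
  qed simp
  have copy: "achieves (for_all_inputs (RStore ''a'' (NVar ''i'') (RLoad ''t'' (NVar ''i'')))) s'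
      (n * 18 + 9)
      (\<lambda>s'. reals s' ''a'' ` {..<n} = a ` {..<n} \<and> sorted_runs (2 * w) n (reals s' ''a''))"
    if t: "?merged s'" and n: "nats s' ''n'' 0 = n" for s'
  proof (rule achieves_for_all_inputs[where
        I = "\<lambda>i s2. reals s2 ''t'' = reals s' ''t'' \<and> (\<forall>p<i. reals s2 ''a'' p = reals s' ''t'' p)"])
    fix s2 assume "reals s2 ''t'' = reals s' ''t'' \<and> (\<forall>p<n. reals s2 ''a'' p = reals s' ''t'' p)"
    moreover from this have "reals s2 ''a'' ` {..<n} = reals s' ''t'' ` {..<n}"
      by (intro image_cong) auto
    ultimately show "reals s2 ''a'' ` {..<n} = a ` {..<n} \<and> sorted_runs (2 * w) n (reals s2 ''a'')"
      using t by (auto simp: sorted_runs_def)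
  qed (use n in \<open>auto simp: less_Suc_eq\<close>)
  have "2 * N \<le> N * (2 * w)" using mult_le_mono2[of 2 "2 * w" N] \<open>0 < w\<close> by (simp add: mult.commute)
  then have small: "2 * N \<le> 3 * n" using N(2) by linarith
  have weight: "N * (100 * w + 76) = 50 * (N * (2 * w)) + 38 * (2 * N)" by (simp add: algebra_simps)
  from small have cost: "N * (100 * w + 76) + (n * 18 + 45) \<le> 600 * n + 30 + 18"
    using N(2) \<open>w < n\<close> weight by linarith
  show ?thesis
    unfolding merge_pass_def
  proof (rule achieves_Seq[where ?B1.0 = 3 and Q = "\<lambda>s'. s' = exec (NSet ''b'' (NConst 0)) s"])
    show "achieves (NSet ''b'' (NConst 0)) s 3 (\<lambda>s'. s' = exec (NSet ''b'' (NConst 0)) s)"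
      by (intro achieves_exec) auto
    fix s' assume s': "s' = exec (NSet ''b'' (NConst 0)) s"
    show "achieves (Seq (Loop (NLess (NVar ''b'') (NVar ''n'')) merge_two_runs)
          (for_all_inputs (RStore ''a'' (NVar ''i'') (RLoad ''t'' (NVar ''i''))))) s'
          (N * (100 * w + 76) + 6 + (n * 18 + 9))
          (\<lambda>s'. reals s' ''a'' ` {..<n} = a ` {..<n} \<and> sorted_runs (2 * w) n (reals s' ''a''))"
    proof (rule achieves_Seq[OF loop[OF s'] copy])
      fix s2 assume "frame (Loop (NLess (NVar ''b'') (NVar ''n'')) merge_two_runs) s' s2"
      from frameD(1)[OF this, of "''n''"] show "nats s2 ''n'' 0 = n" using s s' by simp
    qed auto
  qed (use cost in auto)
qed

text \<open>Each pass doubles the length of the sorted runs and costs \<open>O(n)\<close>, and \<open>L\<close> passes suffice.  The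
invariant bounds the number \<open>j\<close> of remaining passes by \<open>n \<le> w * 2 ^ j\<close>.\<close>

lemma merge_sort_correct:
  assumes s: "reals s ''a'' = a" "nats s ''n'' 0 = n" and L: "n \<le> 2 ^ L"
  shows "achieves merge_sort s (L * (600 * n + 46) + 9)
     (\<lambda>s'. reals s' ''a'' ` {..<n} = a ` {..<n} \<and> mono_on {..<n} (reals s' ''a''))"
proof -
  define I where "I j s' \<longleftrightarrow> (\<exists>w>0. nats s' ''w'' 0 = w \<and> n \<le> w * 2 ^ j \<and>
      reals s' ''a'' ` {..<n} = a ` {..<n} \<and> sorted_runs w n (reals s' ''a''))" for j and s' :: state
  let ?c = "Seq merge_pass (NSet ''w'' (NAdd (NVar ''w'') (NVar ''w'')))"
  have "achieves (Loop (NLess (NVar ''w'') (NVar ''n'')) ?c) s' (L * (600 * n + 46) + 6)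
     (\<lambda>s'. reals s' ''a'' ` {..<n} = a ` {..<n} \<and> mono_on {..<n} (reals s' ''a''))"
    (is "achieves _ _ ?B ?Q") if s': "s' = exec (NSet ''w'' (NConst 1)) s" for s'
  proof (rule achieves_Loop[where I = I and N = L and B = "600 * n + 40"])
    show "I L s'" using s L by (auto simp: I_def s' sorted_runs_def)
  next
    fix j s1 assume "I j s1" "bval (NLess (NVar ''w'') (NVar ''n'')) s1"
      and fr: "frame ?c s' s1"
    have n: "nats s1 ''n'' 0 = n" using frameD[OF fr] s s' by simp
    obtain w where w: "w > 0" "nats s1 ''w'' 0 = w" "n \<le> w * 2 ^ j"
      "reals s1 ''a'' ` {..<n} = a ` {..<n}" "sorted_runs w n (reals s1 ''a'')"
      using \<open>I j s1\<close> by (auto simp: I_def)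
    have less: "w < n" using \<open>bval _ _\<close> w n by simp
    then obtain j' where j: "j = Suc j'" using w(3) by (cases j) auto
    show "achieves ?c s1 (600 * n + 40) (\<lambda>s'. \<exists>j'<j. I j' s')"
    proof (rule achieves_Seq[OF merge_pass_correct[OF w(1) less w(5) refl w(2) n]])
      fix s2 :: state
      assume "reals s2 ''a'' ` {..<n} = reals s1 ''a'' ` {..<n} \<and>
          sorted_runs (2 * w) n (reals s2 ''a'')" "frame merge_pass s1 s2"
      then show "achieves (NSet ''w'' (NAdd (NVar ''w'') (NVar ''w''))) s2 10 (\<lambda>s'. \<exists>j'<j. I j' s')"
        using w j by (intro achieves_exec)
          (auto simp: I_def mult_2 algebra_simps dest!: frameD(1)[where x = "''w''"]
             intro!: exI[of _ j'])
    qed simp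
  next
    fix j s1 assume "I j s1" "\<not> bval (NLess (NVar ''w'') (NVar ''n'')) s1"
      and fr: "frame ?c s' s1"
    moreover have "nats s1 ''n'' 0 = n" using frameD[OF fr] s s' by simp
    ultimately obtain w where w: "n \<le> w" "reals s1 ''a'' ` {..<n} = a ` {..<n}"
      "sorted_runs w n (reals s1 ''a'')"
      by (auto simp: I_def not_less)
    then show "reals s1 ''a'' ` {..<n} = a ` {..<n} \<and> mono_on {..<n} (reals s1 ''a'')"
      by (auto simp: sorted_runs_def intro!: mono_onI)
  qed simp
  from this[OF refl] show ?thesis
    unfolding merge_sort_def by (rule achieves_Seq_exec[rotated]) auto
qed

section \<open>Pivots and Fermat-Weber points through unit vectors\<close>

definition cross2 :: "real^2 \<Rightarrow> real^2 \<Rightarrow> real" where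
  "cross2 u v = u $ 1 * v $ 2 - u $ 2 * v $ 1"

definition unit_sum :: "(real^2) set \<Rightarrow> real^2 \<Rightarrow> real^2" where
  "unit_sum T p = (\<Sum>r\<in>T. sgn (r - p))"

text \<open>The tangent of the angle from \<open>d\<close> to \<open>w\<close>.  Division by zero yields 0, so \<open>slope d 0 = 0\<close>.\<close>

definition slope :: "real^2 \<Rightarrow> real^2 \<Rightarrow> real" where
  "slope d w = cross2 d w / (d \<bullet> w)"

text \<open>The reflection in the line spanned by the unit vector \<open>d\<close>.\<close>

definition mirror :: "real^2 \<Rightarrow> real^2 \<Rightarrow> real^2" where
  "mirror d w = (2 * (w \<bullet> d)) *\<^sub>R d - w"

text \<open>A criterion for \<open>p\<close> to be the pivot of an extension to which \<open>T\<close> belongs.  That no point lies on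
the axis is implied: \<open>p\<close> has key 0, and the keys are distinct.\<close>

definition pivot :: "(real^2) set \<Rightarrow> real^2 \<Rightarrow> bool" where
  "pivot T p \<longleftrightarrow> (let key = (\<lambda>r. slope (unit_sum T p) (r - p)) in
     (\<forall>r\<in>T - {p}. 0 < unit_sum T p \<bullet> (r - p)) \<and> inj_on key T \<and> uminus ` key ` T \<subseteq> key ` T)"

lemma slope_zero [simp]: "slope d 0 = 0"
  by (simp add: slope_def)

lemma slope_scale: "a > 0 \<Longrightarrow> slope (a *\<^sub>R d) w = slope d w" "a > 0 \<Longrightarrow> slope d (a *\<^sub>R w) = slope d w"
  by (simp_all add: slope_def cross2_def right_diff_distrib[symmetric] mult.left_commute mult.assoc)

lemma slope_mirror: "norm d = 1 \<Longrightarrow> slope d (mirror d w) = - slope d w"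
  by (simp add: slope_def cross2_def mirror_def inner_diff_right inner_commute dot_square_norm
      algebra_simps minus_divide_left)

definition perp :: "real^2 \<Rightarrow> real^2" where
  "perp d = vector [- d $ 2, d $ 1]"

lemma orthogonal_decomposition:
  assumes "norm d = 1"
  shows "w = (d \<bullet> w) *\<^sub>R d + cross2 d w *\<^sub>R perp d"
proof -
  have "d $ 1 * d $ 1 + d $ 2 * d $ 2 = 1"
    using assms by (simp add: norm_eq_1 inner_vec_def sum_2)
  then have "w $ 1 = (d \<bullet> w) * d $ 1 - cross2 d w * d $ 2" "w $ 2 = (d \<bullet> w) * d $ 2 + cross2 d w * d $ 1"
    by (simp_all add: inner_vec_def sum_2 cross2_def) algebra+
  then show ?thesis by (simp add: vec_eq_iff forall_2 perp_def)
qed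

lemma direction_from_slope:
  assumes "norm d = 1" "d \<bullet> w \<noteq> 0"
  shows "w = (d \<bullet> w) *\<^sub>R (d + slope d w *\<^sub>R perp d)"
  using orthogonal_decomposition[OF assms(1), of w] assms(2)
  by (simp add: slope_def scaleR_add_right)

lemma norm_slope:
  assumes "norm d = 1"
  shows "(norm (d + k *\<^sub>R perp d))\<^sup>2 = 1 + k\<^sup>2" "d \<bullet> (d + k *\<^sub>R perp d) = 1"
    "slope d (d + k *\<^sub>R perp d) = k"
proof -
  have 1: "d $ 1 * d $ 1 + d $ 2 * d $ 2 = 1"
    using assms by (simp add: norm_eq_1 inner_vec_def sum_2)
  show 2: "d \<bullet> (d + k *\<^sub>R perp d) = 1"
    using 1 by (simp add: inner_vec_def sum_2 perp_def algebra_simps)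
  show "(norm (d + k *\<^sub>R perp d))\<^sup>2 = 1 + k\<^sup>2"
    using 1 unfolding power2_norm_eq_inner
    by (simp add: inner_vec_def sum_2 perp_def) algebra
  have "cross2 d (d + k *\<^sub>R perp d) = k"
    using 1 unfolding cross2_def by (simp add: perp_def) algebra
  with 2 show "slope d (d + k *\<^sub>R perp d) = k" by (simp add: slope_def)
qed

lemma square_div_cancel: "(D :: real) > 0 \<Longrightarrow> (2 / D)\<^sup>2 * D = 2 * (2 / D)"
  by (simp add: power2_eq_square)

text \<open>For a unit vector \<open>d\<close>: the point different from 0 in which the ray from 0 with slope \<open>k\<close> relative to \<open>d\<close>
meets the unit circle around \<open>d\<close>.  It parametrizes that circle, without the point 0, by the slope.\<close>

definition circle_point :: "real^2 \<Rightarrow> real \<Rightarrow> real^2" where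
  "circle_point d k = (2 / (1 + k\<^sup>2)) *\<^sub>R (d + k *\<^sub>R perp d)"

lemma one_plus_square_pos: "0 < 1 + (k :: real)\<^sup>2"
  by (simp add: add_pos_nonneg)

lemma circle_point:
  assumes "norm d = 1"
  shows "norm (circle_point d k - d) = 1" "d \<bullet> circle_point d k > 0" "slope d (circle_point d k) = k"
    "mirror d (circle_point d k) = circle_point d (- k)"
proof -
  note pos = one_plus_square_pos[of k]
  have ip: "d \<bullet> circle_point d k = 2 / (1 + k\<^sup>2)"
    using norm_slope(2)[OF assms, of k] by (simp add: circle_point_def)
  then show "d \<bullet> circle_point d k > 0" using pos by simp
  show "slope d (circle_point d k) = k"
    using pos norm_slope(3)[OF assms] by (simp add: circle_point_def slope_scale(2))
  have "(norm (circle_point d k))\<^sup>2 = (2 / (1 + k\<^sup>2))\<^sup>2 * (1 + k\<^sup>2)"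
    by (simp only: circle_point_def norm_scaleR power_mult_distrib power2_abs norm_slope(1)[OF assms])
  also have "\<dots> = 2 * (d \<bullet> circle_point d k)"
    using square_div_cancel[OF pos] by (simp add: ip)
  finally have "(norm (circle_point d k - d))\<^sup>2 = 1"
    using assms by (simp add: power2_norm_eq_inner inner_diff inner_commute norm_eq_1)
  then show "norm (circle_point d k - d) = 1"
    by (metis norm_ge_zero power2_eq_imp_eq one_power2 zero_le_one)
  have "mirror d (circle_point d k) = (2 / (1 + k\<^sup>2)) *\<^sub>R (2 *\<^sub>R d - (d + k *\<^sub>R perp d))"
    using ip by (simp add: mirror_def inner_commute) (simp add: circle_point_def scaleR_diff_right)
  also have "\<dots> = circle_point d (- k)"
    by (simp add: circle_point_def scaleR_2)
  finally show "mirror d (circle_point d k) = circle_point d (- k)" .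
qed

text \<open>The equation of the circle is \<open>w \<bullet> w = 2 * (d \<bullet> w)\<close>.  Hence the slope determines the length of \<open>w\<close>.\<close>

lemma on_circle:
  assumes "norm d = 1" "norm (w - d) = 1" "w \<noteq> 0"
  shows "d \<bullet> w > 0" "w = circle_point d (slope d w)"
proof -
  have *: "w \<bullet> w = 2 * (d \<bullet> w)"
    using assms(1,2) by (simp add: norm_eq_1 inner_diff inner_commute)
  then show pos: "d \<bullet> w > 0" using assms(3) by (metis inner_gt_zero_iff zero_less_mult_pos zero_less_numeral)
  let ?k = "slope d w"
  have w: "w = (d \<bullet> w) *\<^sub>R (d + ?k *\<^sub>R perp d)"
    using direction_from_slope[OF assms(1)] pos by auto
  have "w \<bullet> w = (d \<bullet> w)\<^sup>2 * (1 + ?k\<^sup>2)"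
    using arg_cong2[where f = inner, OF w w]
    by (simp only: inner_scaleR_left inner_scaleR_right power2_eq_square mult.assoc
        norm_slope(1)[OF assms(1), unfolded power2_norm_eq_inner])
  with * pos have "d \<bullet> w * (1 + ?k\<^sup>2) = 2" by (simp add: power2_eq_square)
  then have "d \<bullet> w = 2 / (1 + ?k\<^sup>2)"
    using one_plus_square_pos[of ?k] by (simp add: field_simps)
  with w show "w = circle_point d ?k" unfolding circle_point_def by metis
qed

lemma reflect_in_axis:
  assumes "norm (c - p) = 1"
  shows "reflect_in_line c p x = p + mirror (c - p) (x - p)"
proof -
  define d w where "d = c - p" and "w = x - p"
  have d: "d \<bullet> d = 1" using assms by (simp add: d_def norm_eq_1)
  have e: "p - c = - d" "x - c = w - d" "c = p + d" by (simp_all add: d_def w_def)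
  show ?thesis
    unfolding reflect_in_line_def e(1,2) mirror_def d_def[symmetric] w_def[symmetric]
    using d by (simp add: e(3) inner_diff_left algebra_simps scaleR_2)
qed

lemma on_axis_iff:
  assumes "norm (c - p) = 1"
  shows "x \<in> affine hull {c, p} \<longleftrightarrow> cross2 (c - p) (x - p) = 0"
proof
  assume "x \<in> affine hull {c, p}"
  then obtain u v where "x = u *\<^sub>R c + v *\<^sub>R p" "u + v = 1" by (auto simp: affine_hull_2)
  then have "x = u *\<^sub>R c + (1 - u) *\<^sub>R p" by (metis add_diff_cancel_left')
  then have "x - p = u *\<^sub>R (c - p)" unfolding vec_eq_iff by (simp add: left_diff_distrib right_diff_distrib)
  then show "cross2 (c - p) (x - p) = 0" by (simp add: cross2_def)
next
  assume 0: "cross2 (c - p) (x - p) = 0"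
  define u where "u = (c - p) \<bullet> (x - p)"
  have "x - p = u *\<^sub>R (c - p)"
    using orthogonal_decomposition[OF assms, of "x - p"] 0 by (simp add: u_def)
  then have "x = u *\<^sub>R c + (1 - u) *\<^sub>R p" by (simp add: algebra_simps)
  then show "x \<in> affine hull {c, p}" unfolding affine_hull_2 by force
qed

lemma mirror_sgn: "norm d = 1 \<Longrightarrow> mirror d (sgn w) = sgn (mirror d w)"
proof -
  assume d: "norm d = 1"
  have "mirror d w \<bullet> mirror d w = w \<bullet> w"
    using d by (simp add: mirror_def inner_diff norm_eq_1 inner_commute)
  then have "norm (mirror d w) = norm w" by (simp add: norm_eq_sqrt_inner)
  then show ?thesis by (simp add: sgn_div_norm mirror_def scaleR_diff_right)
qed

lemma mirror_mirror: "norm d = 1 \<Longrightarrow> mirror d (mirror d w) = w"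
  by (simp add: mirror_def inner_diff_left norm_eq_1)

lemma mirror_sum: "mirror d (\<Sum>x\<in>A. f x) = (\<Sum>x\<in>A. mirror d (f x))"
  by (simp add: mirror_def inner_sum_left sum_distrib_left scaleR_sum_left sum_subtractf)

lemma sgn_pos_scale: "a > 0 \<Longrightarrow> sgn (a *\<^sub>R (w :: real^2)) = sgn w"
  by (simp add: sgn_scaleR)

text \<open>The reflection permutes the points of \<open>S\<close> other than \<open>p\<close>, so it fixes the sum \<open>v\<close> of their unit
directions, which therefore is a positive multiple of \<open>d\<close>.  Moving points along their rays changes
neither \<open>v\<close> nor the slopes.  Slopes are distinct because a point of the circle is determined by its
slope, and they are closed under negation because the reflection negates them.\<close>

lemma pivot_if_extension:
  assumes S: "reflection_symmetric S p" and T: "T \<in> extension S p"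
  shows "pivot T p"
proof -
  from S obtain m c where fin: "finite S" and m: "m \<ge> 1" "card S = 2 * m + 1" and p: "p \<in> S"
    and circ: "S \<subseteq> sphere c 1"
    and sym: "\<And>s. s \<in> S - {p} \<Longrightarrow> s \<notin> affine hull {c, p} \<and> reflect_in_line c p s \<in> S - {p, s}"
    unfolding reflection_symmetric_def by blast
  from T obtain t where t: "\<And>s. s \<in> S - {p} \<Longrightarrow> 0 < t s"
    and T: "T = insert p ((\<lambda>s. p + t s *\<^sub>R (s - p)) ` (S - {p}))"
    unfolding extension_def by blast
  define d where "d = c - p"
  have d: "norm d = 1" using p circ by (auto simp: d_def dist_norm)
  let ?S = "S - {p}"
  let ?f = "\<lambda>s. p + t s *\<^sub>R (s - p)"
  have nd: "norm (s - p - d) = 1" if "s \<in> S" for s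
    using that circ by (auto simp: d_def dist_norm norm_minus_commute)
  have w: "d \<bullet> (s - p) > 0" "s - p = circle_point d (slope d (s - p))" if "s \<in> ?S" for s
    using on_circle[OF d nd] that by auto
  have slope_f: "slope d (?f s - p) = slope d (s - p)" if "s \<in> ?S" for s
    using t[OF that] by (simp add: slope_scale)
  have slope_nz: "slope d (s - p) \<noteq> 0" if "s \<in> ?S" for s
    using sym[OF that] w(1)[OF that] on_axis_iff[of c p s] d by (simp add: slope_def d_def)
  have inj_S: "inj_on (\<lambda>s. slope d (s - p)) ?S"
    by (rule inj_onI) (metis w(2) diff_add_cancel)
  have inj_f: "inj_on ?f ?S"
    by (rule inj_onI) (metis slope_f inj_S inj_onD)
  have p_notin: "p \<notin> ?f ` ?S" using t by force
  define \<rho> where "\<rho> s = p + mirror d (s - p)" for s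
  have \<rho>: "\<rho> s \<in> ?S" if "s \<in> ?S" for s
    using sym[OF that] reflect_in_axis[of c p s] d by (auto simp: \<rho>_def d_def)
  have \<rho>2: "\<rho> (\<rho> s) = s" for s
    using d by (simp add: \<rho>_def mirror_mirror)
  have bij: "bij_betw \<rho> ?S ?S"
    by (rule bij_betwI[where g = \<rho>]) (use \<rho> \<rho>2 in auto)
  define v where "v = (\<Sum>s\<in>?S. sgn (s - p))"
  have v: "unit_sum T p = v"
  proof -
    have "unit_sum T p = (\<Sum>r\<in>?f ` ?S. sgn (r - p))"
      unfolding unit_sum_def T using fin p_notin by (subst sum.insert) auto
    also have "\<dots> = (\<Sum>s\<in>?S. sgn (?f s - p))"
      by (simp add: sum.reindex[OF inj_f] del: add_diff_cancel_left')
    also have "\<dots> = v"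
      unfolding v_def by (rule sum.cong[OF refl]) (use t in \<open>simp add: sgn_pos_scale\<close>)
    finally show ?thesis .
  qed
  have "mirror d v = (\<Sum>s\<in>?S. sgn (\<rho> s - p))"
    by (simp add: v_def mirror_sum mirror_sgn[OF d] \<rho>_def)
  also have "\<dots> = v"
    unfolding v_def by (rule sum.reindex_bij_betw[OF bij])
  finally have "2 *\<^sub>R v = (2 * (v \<bullet> d)) *\<^sub>R d"
    by (simp add: mirror_def scaleR_2 diff_eq_eq)
  then have "(1 / 2) *\<^sub>R (2 *\<^sub>R v) = (1 / 2) *\<^sub>R ((2 * (v \<bullet> d)) *\<^sub>R d)" by (rule arg_cong)
  then have vd: "v = (v \<bullet> d) *\<^sub>R d" by simp
  have "?S \<noteq> {}"
  proof
    assume "?S = {}" then have "S = {p}" using p by auto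
    with m show False by simp
  qed
  then have lam: "v \<bullet> d > 0"
    unfolding v_def inner_sum_left using fin w(1)
    by (intro sum_pos) (auto simp: sgn_div_norm inner_commute intro!: mult_pos_pos)
  have key: "slope (unit_sum T p) = slope d"
    unfolding v by (subst vd) (rule ext, simp add: slope_scale lam)
  have keyT: "(\<lambda>r. slope d (r - p)) ` T = insert 0 ((\<lambda>s. slope d (s - p)) ` ?S)"
    unfolding T image_insert image_image using slope_f by (auto simp: image_iff)
  have "inj_on (\<lambda>r. slope d (r - p)) T"
    unfolding T
  proof (subst inj_on_insert, intro conjI)
    show "inj_on (\<lambda>r. slope d (r - p)) (?f ` ?S)"
      by (rule inj_on_imageI) (use inj_S in \<open>auto simp: inj_on_def slope_scale(2)[OF t]\<close>)
    show "slope d (p - p) \<notin> (\<lambda>r. slope d (r - p)) ` (?f ` ?S - {p})"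
      using slope_f slope_nz by (auto simp: image_iff)
  qed
  moreover have "uminus ` (\<lambda>r. slope d (r - p)) ` T \<subseteq> (\<lambda>r. slope d (r - p)) ` T"
  proof -
    have "- slope d (s - p) \<in> (\<lambda>s. slope d (s - p)) ` ?S" if "s \<in> ?S" for s
      using \<rho>[OF that] slope_mirror[OF d, of "s - p"] by (intro image_eqI[of _ _ "\<rho> s"]) (auto simp: \<rho>_def)
    then show ?thesis unfolding keyT by auto
  qed
  moreover have "0 < unit_sum T p \<bullet> (r - p)" if r: "r \<in> T - {p}" for r
  proof -
    obtain s where "s \<in> ?S" "r = ?f s" using r unfolding T by blast
    then show ?thesis unfolding v using w(1)[of s] t[of s] lam
      by (subst vd) (simp add: mult_pos_pos)
  qed
  ultimately show ?thesis unfolding pivot_def Let_def key by blast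
qed

text \<open>The set \<open>S\<close> arises by moving every point of \<open>T\<close> along its ray from \<open>p\<close> to the unit circle that passes
through \<open>p\<close> and has its center on the axis in the direction of \<open>v\<close>.\<close>

lemma extension_if_pivot:
  assumes fin: "finite T" and card: "card T = 2 * m + 1" "m \<ge> 1" and p: "p \<in> T" and piv: "pivot T p"
  shows "\<exists>S. reflection_symmetric S p \<and> T \<in> extension S p"
proof -
  define v where "v = unit_sum T p"
  define d where "d = sgn v"
  have pos: "0 < v \<bullet> (r - p)" if "r \<in> T - {p}" for r
    using piv that by (auto simp: pivot_def v_def Let_def)
  have "T - {p} \<noteq> {}"
  proof
    assume "T - {p} = {}" then have "T = {p}" using p by auto
    with card show False by simp
  qed
  then have "v \<noteq> 0" using pos by force
  then have d: "norm d = 1" and vd: "v = norm v *\<^sub>R d" "norm v > 0"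
    by (simp_all add: d_def norm_sgn sgn_div_norm)
  have posd: "0 < d \<bullet> (r - p)" if "r \<in> T - {p}" for r
    using pos[OF that] vd by (metis inner_scaleR_left zero_less_mult_pos)
  define key where "key r = slope d (r - p)" for r
  have key: "slope v (r - p) = key r" for r
    unfolding key_def by (subst vd(1)) (simp only: slope_scale(1)[OF vd(2)])
  have inj: "inj_on key T" and neg: "uminus ` key ` T \<subseteq> key ` T"
    using piv unfolding pivot_def Let_def v_def[symmetric] key by auto
  have key_p: "key p = 0" by (simp add: key_def)
  have key_nz: "key r \<noteq> 0" if "r \<in> T - {p}" for r
    using inj that p key_p by (metis DiffE inj_onD singletonI)
  define c where "c = p + d"
  define g where "g r = p + circle_point d (key r)" for r
  let ?T = "T - {p}"
  have inj_g: "inj_on g ?T"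
  proof (rule inj_onI)
    fix r r' assume "r \<in> ?T" "r' \<in> ?T" "g r = g r'"
    then have "slope d (circle_point d (key r)) = slope d (circle_point d (key r'))"
      by (simp add: g_def)
    then have "key r = key r'" by (simp add: circle_point(3)[OF d])
    with inj \<open>r \<in> ?T\<close> \<open>r' \<in> ?T\<close> show "r = r'" by (auto dest: inj_onD)
  qed
  have gp: "g r \<noteq> p" for r using circle_point(2)[OF d, of "key r"] by (auto simp: g_def)
  define S where "S = insert p (g ` ?T)"
  have SP: "S - {p} = g ` ?T" using gp by (auto simp: S_def)
  define \<sigma> where "\<sigma> r = 2 / (1 + (key r)\<^sup>2) / (d \<bullet> (r - p))" for r
  have \<sigma>: "\<sigma> r > 0" "g r - p = \<sigma> r *\<^sub>R (r - p)" if "r \<in> ?T" for r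
  proof -
    show "\<sigma> r > 0" using posd[OF that] one_plus_square_pos[of "key r"] by (simp add: \<sigma>_def)
    have "r - p = (d \<bullet> (r - p)) *\<^sub>R (d + key r *\<^sub>R perp d)"
      unfolding key_def using direction_from_slope[OF d, of "r - p"] posd[OF that] by simp
    then have "\<sigma> r *\<^sub>R (r - p) = (\<sigma> r * (d \<bullet> (r - p))) *\<^sub>R (d + key r *\<^sub>R perp d)"
      by (metis scaleR_scaleR)
    also have "\<dots> = circle_point d (key r)"
      using posd[OF that] by (simp add: \<sigma>_def circle_point_def)
    finally show "g r - p = \<sigma> r *\<^sub>R (r - p)" by (simp add: g_def)
  qed
  define t where "t s = 1 / \<sigma> (inv_into ?T g s)" for s
  have t: "t (g r) = 1 / \<sigma> r" if "r \<in> ?T" for r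
    using that inj_g by (simp add: t_def)
  have "T = insert p ((\<lambda>s. p + t s *\<^sub>R (s - p)) ` (S - {p}))"
  proof -
    have "p + t (g r) *\<^sub>R (g r - p) = r" if "r \<in> ?T" for r
      using \<sigma>[OF that] t[OF that] by simp
    then have "(\<lambda>s. p + t s *\<^sub>R (s - p)) ` (S - {p}) = ?T"
      unfolding SP image_image by simp
    then show ?thesis using p by auto
  qed
  moreover have "\<forall>s\<in>S - {p}. 0 < t s" unfolding SP using t \<sigma>(1) by auto
  ultimately have "T \<in> extension S p" unfolding extension_def by blast
  moreover have "reflection_symmetric S p"
    unfolding reflection_symmetric_def
  proof (intro conjI exI[of _ m] exI[of _ c] ballI)
    show "finite S" using fin by (simp add: S_def)
    have "card S = Suc (card ?T)"
      unfolding S_def using gp fin by (subst card_insert_disjoint) (auto simp: card_image[OF inj_g])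
    then show "card S = 2 * m + 1" using card p fin by simp
    show "p \<in> S" by (simp add: S_def)
    show "S \<subseteq> sphere c 1"
      using circle_point(1)[OF d] d by (auto simp: S_def g_def c_def dist_norm norm_minus_commute)
    fix s assume "s \<in> S - {p}"
    then obtain r where r: "r \<in> ?T" "s = g r" unfolding SP by blast
    have cd: "norm (c - p) = 1" using d by (simp add: c_def)
    show "s \<notin> affine hull {c, p}"
      using key_nz[OF r(1)] circle_point(3)[OF d, of "key r"]
      unfolding on_axis_iff[OF cd] by (auto simp: r(2) g_def c_def slope_def)
    from neg r obtain r' where r': "r' \<in> T" "key r' = - key r" by (metis (no_types) DiffE image_eqI image_iff subsetD)
    then have "r' \<noteq> p" "r' \<noteq> r" using key_nz[OF r(1)] key_p by auto
    moreover have "reflect_in_line c p s = g r'"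
      unfolding reflect_in_axis[OF cd] using r' circle_point(4)[OF d] by (simp add: r(2) g_def c_def)
    ultimately show "reflect_in_line c p s \<in> S - {p, s}"
      using r r' gp inj_onD[OF inj_g, of r r'] by (auto simp: S_def)
  qed (use card in auto)
  ultimately show ?thesis by blast
qed

text \<open>The tangent of the convex function \<open>q \<mapsto> dist q s\<close> at \<open>p\<close> is a lower bound; for \<open>s = p\<close> it is the
zero function, as \<open>sgn 0 = 0\<close>.\<close>

lemma dist_linear_lower:
  fixes s p q :: "real^2"
  shows "dist p s - sgn (s - p) \<bullet> (q - p) \<le> dist q s"
proof -
  have "sgn (s - p) \<bullet> (s - q) \<le> norm (sgn (s - p)) * norm (s - q)" by (rule norm_cauchy_schwarz)
  also have "\<dots> \<le> dist q s" by (simp add: norm_sgn dist_norm norm_minus_commute)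
  finally have "sgn (s - p) \<bullet> (s - q) \<le> dist q s" .
  moreover have "sgn (s - p) \<bullet> (s - p) = dist p s"
    by (cases "s = p")
       (simp_all add: sgn_div_norm dist_norm norm_minus_commute dot_square_norm power2_eq_square)
  moreover have "sgn (s - p) \<bullet> (s - q) = sgn (s - p) \<bullet> (s - p) - sgn (s - p) \<bullet> (q - p)"
    by (simp add: inner_diff_right)
  ultimately show ?thesis by linarith
qed

text \<open>A bound of second order in \<open>e\<close>, from the arithmetic-geometric mean inequality for the norms of \<open>s - p\<close>
and \<open>s - p - e *\<^sub>R v\<close>.\<close>

lemma dist_linear_upper:
  fixes s p v :: "real^2"
  assumes "s \<noteq> p"
  shows "dist (p + e *\<^sub>R v) s \<le> dist p s - e * (sgn (s - p) \<bullet> v) + e\<^sup>2 * ((norm v)\<^sup>2 / (2 * dist p s))"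
proof -
  define w where "w = s - p"
  have w: "norm w > 0" "dist p s = norm w" "dist (p + e *\<^sub>R v) s = norm (w - e *\<^sub>R v)"
    using assms by (auto simp: w_def dist_norm norm_minus_commute algebra_simps)
  have "2 * norm w * norm (w - e *\<^sub>R v) \<le> (norm w)\<^sup>2 + (norm (w - e *\<^sub>R v))\<^sup>2"
    by (rule sum_squares_bound)
  also have "\<dots> = 2 * (norm w)\<^sup>2 - 2 * e * (w \<bullet> v) + e\<^sup>2 * (norm v)\<^sup>2"
    unfolding power2_norm_eq_inner
    by (simp add: inner_diff inner_commute power2_eq_square algebra_simps)
  finally have "norm (w - e *\<^sub>R v) \<le> (2 * (norm w)\<^sup>2 - 2 * e * (w \<bullet> v) + e\<^sup>2 * (norm v)\<^sup>2) / (2 * norm w)"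
    using w(1) by (simp add: pos_le_divide_eq mult.commute mult.left_commute)
  also have "\<dots> = norm w - e * (sgn w \<bullet> v) + e\<^sup>2 * ((norm v)\<^sup>2 / (2 * norm w))"
    using w(1) by (simp add: sgn_div_norm field_simps power2_eq_square)
  finally show ?thesis unfolding w by (simp add: w_def)
qed

text \<open>The term of the point \<open>p\<close> itself grows like \<open>norm (q - p)\<close>, the other terms together fall at rate
at most \<open>v \<bullet> (q - p)\<close>.  If \<open>norm v > 1\<close>, a small step in direction \<open>v\<close> decreases the sum.\<close>

lemma fermat_weber_point_iff:
  assumes fin: "finite T" and p: "p \<in> T"
  shows "fermat_weber_point T p \<longleftrightarrow> norm (unit_sum T p) \<le> 1"
proof -
  let ?T = "T - {p}"
  define v where "v = unit_sum T p"
  have v: "v = (\<Sum>s\<in>?T. sgn (s - p))"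
    unfolding v_def unit_sum_def using fin p by (subst sum.remove[OF fin p]) simp
  have split: "(\<Sum>s\<in>T. dist q s) = dist q p + (\<Sum>s\<in>?T. dist q s)" for q
    by (rule sum.remove[OF fin p])
  show ?thesis
    unfolding v_def[symmetric] fermat_weber_point_def is_arg_min_linorder
  proof (intro iffI conjI allI impI)
    assume le: "norm v \<le> 1"
    fix q
    have "(\<Sum>s\<in>?T. dist p s - sgn (s - p) \<bullet> (q - p)) \<le> (\<Sum>s\<in>?T. dist q s)"
      by (rule sum_mono) (rule dist_linear_lower)
    then have "(\<Sum>s\<in>?T. dist p s) - v \<bullet> (q - p) \<le> (\<Sum>s\<in>?T. dist q s)"
      by (simp add: v sum_subtractf inner_sum_left)
    moreover have "v \<bullet> (q - p) \<le> dist q p"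
      using norm_cauchy_schwarz[of v "q - p"] mult_right_mono[OF le norm_ge_zero[of "q - p"]]
      by (simp add: dist_norm)
    ultimately show "(\<Sum>s\<in>T. dist p s) \<le> (\<Sum>s\<in>T. dist q s)" by (simp add: split)
  next
    assume "True \<and> (\<forall>q. True \<longrightarrow> (\<Sum>s\<in>T. dist p s) \<le> (\<Sum>s\<in>T. dist q s))"
    then have min: "(\<Sum>s\<in>T. dist p s) \<le> (\<Sum>s\<in>T. dist q s)" for q by blast
    define K where "K = (\<Sum>s\<in>?T. (norm v)\<^sup>2 / (2 * dist p s))"
    have K: "0 \<le> K" unfolding K_def by (intro sum_nonneg) auto
    have bound: "(norm v)\<^sup>2 - norm v \<le> e * K" if "e > 0" for e
    proof -
      have dp: "dist (p + e *\<^sub>R v) p = e * norm v" using that by (simp add: dist_norm)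
      have "(\<Sum>s\<in>?T. dist (p + e *\<^sub>R v) s) \<le>
          (\<Sum>s\<in>?T. dist p s - e * (sgn (s - p) \<bullet> v) + e\<^sup>2 * ((norm v)\<^sup>2 / (2 * dist p s)))"
        by (intro sum_mono dist_linear_upper) auto
      also have "\<dots> = (\<Sum>s\<in>?T. dist p s) - e * (v \<bullet> v) + e\<^sup>2 * K"
        by (subst (3) v) (simp add: sum.distrib sum_subtractf inner_sum_left sum_distrib_left K_def)
      finally have "0 \<le> e * norm v - e * (v \<bullet> v) + e\<^sup>2 * K"
        using min[of "p + e *\<^sub>R v"] dp by (simp add: split)
      then have "e * ((norm v)\<^sup>2 - norm v) \<le> e * (e * K)"
        unfolding power2_norm_eq_inner by (simp add: algebra_simps power2_eq_square)
      then show ?thesis using that by simp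
    qed
    show "norm v \<le> 1"
    proof (rule ccontr)
      assume "\<not> norm v \<le> 1"
      then have "0 < norm v * (norm v - 1)" by (intro mult_pos_pos) linarith+
      then have D: "(norm v)\<^sup>2 - norm v > 0" by (simp add: power2_eq_square algebra_simps)
      \<comment> \<open>small enough for the gain of first order to exceed the error \<open>e\<^sup>2 * K\<close>; \<open>K + 1\<close> avoids division by 0\<close>
      define e where "e = ((norm v)\<^sup>2 - norm v) / (2 * (K + 1))"
      have "e > 0" using D K by (simp add: e_def)
      moreover have "e * K < (norm v)\<^sup>2 - norm v"
        using D K by (simp add: e_def divide_less_eq)
      ultimately show False using bound[of e] by linarith
    qed
  qed auto
qed

lemma hull_vertex_if_exposed:
  assumes fin: "finite T" and p: "p \<in> T" and f: "\<And>r. r \<in> T \<Longrightarrow> r \<noteq> p \<Longrightarrow> 0 < f \<bullet> (r - p)"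
  shows "p extreme_point_of (convex hull T)"
proof -
  have "convex hull (T - {p}) \<subseteq> {x. f \<bullet> x > f \<bullet> p}"
    by (rule hull_minimal) (use f in \<open>auto simp: inner_diff_right convex_halfspace_gt\<close>)
  then have "p \<notin> convex hull (T - {p})" by auto
  then show ?thesis
    using extreme_point_of_convex_hull_insert[of "T - {p}" p] fin p by (simp add: insert_absorb)
qed

section \<open>Deciding whether one point is a pivot\<close>

definition pt :: "(nat \<Rightarrow> real) \<Rightarrow> (nat \<Rightarrow> real) \<Rightarrow> nat \<Rightarrow> real^2" where
  "pt X Y i = vector [X i, Y i]"

lemma pt_component [simp]: "pt X Y i $ 1 = X i" "pt X Y i $ 2 = Y i"
  by (simp_all add: pt_def)

definition pts :: "(nat \<Rightarrow> real) \<Rightarrow> (nat \<Rightarrow> real) \<Rightarrow> nat \<Rightarrow> (real^2) set" where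
  "pts X Y n = pt X Y ` {..<n}"

definition set_offset :: com where
  "set_offset =
     Seq (RSet ''dx'' (RSub (RLoad ''x'' (NVar ''i'')) (RLoad ''x'' (NVar ''c''))))
         (RSet ''dy'' (RSub (RLoad ''y'' (NVar ''i'')) (RLoad ''y'' (NVar ''c''))))"

text \<open>The point \<open>c\<close> itself contributes \<open>0 / 0 = 0\<close>, in agreement with \<open>sgn 0 = 0\<close>.\<close>

definition sum_units :: com where
  "sum_units = Seq (Seq (RSet ''u'' (RConst 0)) (RSet ''v'' (RConst 0)))
    (for_all_inputs
      (Seq set_offset
      (Seq (RSet ''d'' (RSqrt (RAdd (RMul (RVar ''dx'') (RVar ''dx'')) (RMul (RVar ''dy'') (RVar ''dy'')))))
      (Seq (RSet ''u'' (RAdd (RVar ''u'') (RDiv (RVar ''dx'') (RVar ''d''))))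
           (RSet ''v'' (RAdd (RVar ''v'') (RDiv (RVar ''dy'') (RVar ''d''))))))))"

definition compute_keys :: com where
  "compute_keys = Seq (NSet ''ok'' (NConst 1))
    (for_all_inputs
      (Seq set_offset
      (Seq (RSet ''d'' (RAdd (RMul (RVar ''u'') (RVar ''dx'')) (RMul (RVar ''v'') (RVar ''dy''))))
      (Seq (RStore ''a'' (NVar ''i'')
              (RDiv (RSub (RMul (RVar ''u'') (RVar ''dy'')) (RMul (RVar ''v'') (RVar ''dx''))) (RVar ''d'')))
           (Cond (BAnd (BNot (NEq (NVar ''i'') (NVar ''c''))) (BNot (RLess (RConst 0) (RVar ''d''))))
              (NSet ''ok'' (NConst 0)) Skip)))))"

definition test_keys :: com where
  "test_keys = for_all_inputs
    (Seq (Cond (BAnd (NLess (NAdd (NVar ''i'') (NConst 1)) (NVar ''n''))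
                (BNot (RLess (RLoad ''a'' (NVar ''i'')) (RLoad ''a'' (NAdd (NVar ''i'') (NConst 1))))))
            (NSet ''ok'' (NConst 0)) Skip)
         (Cond (REq (RAdd (RLoad ''a'' (NVar ''i''))
                      (RLoad ''a'' (NSub (NVar ''n'') (NAdd (NVar ''i'') (NConst 1))))) (RConst 0))
            Skip (NSet ''ok'' (NConst 0))))"

definition report :: com where
  "report = Cond (NEq (NVar ''ok'') (NConst 1))
     (Seq (NSet ''member'' (NConst 1))
       (Cond (RLess (RConst 1) (RAdd (RMul (RVar ''u'') (RVar ''u'')) (RMul (RVar ''v'') (RVar ''v''))))
          Skip (NSet ''fw_at_pivot'' (NConst 1))))
     Skip"

definition check_candidate :: com where
  "check_candidate = Seq sum_units (Seq compute_keys (Seq merge_sort (Seq test_keys report)))"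

lemma mods_check [simp]:
  "nmods sum_units = {''i''}" "rmods sum_units = {''dx'', ''dy'', ''d'', ''u'', ''v''}"
  "nmods compute_keys = {''i'', ''ok''}" "rmods compute_keys = {''dx'', ''dy'', ''d'', ''a''}"
  "nmods test_keys = {''i'', ''ok''}" "rmods test_keys = {}"
  "nmods report = {''member'', ''fw_at_pivot''}" "rmods report = {}"
  by (auto simp: sum_units_def compute_keys_def test_keys_def report_def set_offset_def)

lemma mods_check_candidate [simp]:
  "nmods check_candidate = {''m'', ''e'', ''l'', ''r'', ''o'', ''b'', ''i'', ''w'', ''ok'', ''member'', ''fw_at_pivot''}"
  "rmods check_candidate = {''dx'', ''dy'', ''d'', ''u'', ''v'', ''a'', ''t''}"
  by (auto simp: check_candidate_def)

lemma sgn_component: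
  "sgn (w :: real^2) $ 1 = w $ 1 / sqrt (w $ 1 * w $ 1 + w $ 2 * w $ 2)"
  "sgn (w :: real^2) $ 2 = w $ 2 / sqrt (w $ 1 * w $ 1 + w $ 2 * w $ 2)"
  by (simp_all add: sgn_div_norm norm_vec_def L2_set_def sum_2 power2_eq_square divide_inverse mult.commute)

lemma sum_units_correct:
  assumes s: "nats s ''n'' 0 = n" "nats s ''c'' 0 = c" "reals s ''x'' = X" "reals s ''y'' = Y"
    and inj: "inj_on (pt X Y) {..<n}"
  shows "achieves sum_units s (n * 70 + 20)
     (\<lambda>s'. reals s' ''u'' 0 = unit_sum (pts X Y n) (pt X Y c) $ 1 \<and>
           reals s' ''v'' 0 = unit_sum (pts X Y n) (pt X Y c) $ 2)"
  unfolding sum_units_def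
proof (rule achieves_Seq_exec)
  let ?S = "\<lambda>j. \<Sum>i<j. sgn (pt X Y i - pt X Y c)"
  have sum: "unit_sum (pts X Y n) (pt X Y c) = ?S n"
    by (simp add: unit_sum_def pts_def sum.reindex[OF inj])
  show "achieves (for_all_inputs
      (Seq set_offset
      (Seq (RSet ''d'' (RSqrt (RAdd (RMul (RVar ''dx'') (RVar ''dx'')) (RMul (RVar ''dy'') (RVar ''dy'')))))
      (Seq (RSet ''u'' (RAdd (RVar ''u'') (RDiv (RVar ''dx'') (RVar ''d''))))
           (RSet ''v'' (RAdd (RVar ''v'') (RDiv (RVar ''dy'') (RVar ''d''))))))))
     (exec (Seq (RSet ''u'' (RConst 0)) (RSet ''v'' (RConst 0))) s) (n * 70 + 10)
     (\<lambda>s'. reals s' ''u'' 0 = unit_sum (pts X Y n) (pt X Y c) $ 1 \<and>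
           reals s' ''v'' 0 = unit_sum (pts X Y n) (pt X Y c) $ 2)"
    (is "achieves (for_all_inputs ?c) ?s _ _")
  proof (rule achieves_for_all_inputs[where
        I = "\<lambda>j s'. reals s' ''u'' 0 = ?S j $ 1 \<and> reals s' ''v'' 0 = ?S j $ 2"])
    fix j s'
    assume I: "reals s' ''u'' 0 = ?S j $ 1 \<and> reals s' ''v'' 0 = ?S j $ 2"
      and i: "nats s' ''i'' 0 = j" and fr: "frame (for_all_inputs ?c) ?s s'"
    note f = frameD[OF fr, simplified mods_for_all_inputs set_offset_def, simplified]
    have "nats s' ''c'' 0 = c" "reals s' ''x'' = X" "reals s' ''y'' = Y"
      using f s by auto
    with I i show "reals (nstore ''i'' 0 (Suc j) (exec ?c s')) ''u'' 0 = ?S (Suc j) $ 1 \<and>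
        reals (nstore ''i'' 0 (Suc j) (exec ?c s')) ''v'' 0 = ?S (Suc j) $ 2"
      by (simp add: set_offset_def sgn_component)
  qed (use s sum in \<open>auto simp: set_offset_def\<close>)
qed auto

lemma compute_keys_correct:
  assumes s: "nats s ''n'' 0 = n" "nats s ''c'' 0 = c" "reals s ''x'' = X" "reals s ''y'' = Y"
    and v: "reals s ''u'' 0 = v $ 1" "reals s ''v'' 0 = v $ 2"
  shows "achieves compute_keys s (n * 80 + 20)
     (\<lambda>s'. (\<forall>i<n. reals s' ''a'' i = slope v (pt X Y i - pt X Y c)) \<and>
           (nats s' ''ok'' 0 = 1 \<longleftrightarrow> (\<forall>i<n. i \<noteq> c \<longrightarrow> 0 < v \<bullet> (pt X Y i - pt X Y c))))"
  unfolding compute_keys_def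
proof (rule achieves_Seq_exec)
  let ?I = "\<lambda>j s'. (\<forall>i<j. reals s' ''a'' i = slope v (pt X Y i - pt X Y c)) \<and>
           (nats s' ''ok'' 0 = 1 \<longleftrightarrow> (\<forall>i<j. i \<noteq> c \<longrightarrow> 0 < v \<bullet> (pt X Y i - pt X Y c)))"
  show "achieves (for_all_inputs
      (Seq set_offset
      (Seq (RSet ''d'' (RAdd (RMul (RVar ''u'') (RVar ''dx'')) (RMul (RVar ''v'') (RVar ''dy''))))
      (Seq (RStore ''a'' (NVar ''i'')
              (RDiv (RSub (RMul (RVar ''u'') (RVar ''dy'')) (RMul (RVar ''v'') (RVar ''dx''))) (RVar ''d'')))
           (Cond (BAnd (BNot (NEq (NVar ''i'') (NVar ''c''))) (BNot (RLess (RConst 0) (RVar ''d''))))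
              (NSet ''ok'' (NConst 0)) Skip)))))
     (exec (NSet ''ok'' (NConst 1)) s) (n * 80 + 10) (?I n)"
    (is "achieves (for_all_inputs ?c) ?s _ _")
  proof (rule achieves_for_all_inputs[where I = ?I])
    fix j s'
    assume I: "?I j s'"
      and i: "nats s' ''i'' 0 = j" and fr: "frame (for_all_inputs ?c) ?s s'"
    note f = frameD[OF fr, simplified mods_for_all_inputs set_offset_def, simplified]
    have "nats s' ''c'' 0 = c" "reals s' ''x'' = X" "reals s' ''y'' = Y"
      "reals s' ''u'' 0 = v $ 1" "reals s' ''v'' 0 = v $ 2"
      using f s v by auto
    with I i show "?I (Suc j) (nstore ''i'' 0 (Suc j) (exec ?c s'))"
      by (auto simp: set_offset_def slope_def cross2_def inner_vec_def sum_2 less_Suc_eq)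
  qed (use s in \<open>auto simp: set_offset_def\<close>)
qed auto

text \<open>If the \<open>n\<close> values of \<open>key\<close> are distinct, then so are those of \<open>a\<close>.  Negating and reversing a strictly
increasing enumeration of a set closed under negation gives a strictly increasing enumeration of
the same set, and there is only one.  Conversely \<open>n\<close> distinct values of \<open>a\<close> force \<open>key\<close> to be injective.\<close>

lemma strictly_sorted_and_odd_iff:
  fixes a key :: "nat \<Rightarrow> real"
  assumes mono: "mono_on {..<n} a" and im: "a ` {..<n} = key ` {..<n}"
  shows "(\<forall>i<n. (Suc i < n \<longrightarrow> a i < a (Suc i)) \<and> a i + a (n - Suc i) = 0) \<longleftrightarrow>
     inj_on key {..<n} \<and> uminus ` key ` {..<n} \<subseteq> key ` {..<n}" (is "?L \<longleftrightarrow> ?R")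
proof
  assume L: ?L
  have less: "a i < a j" if "i < j" "j < n" for i j
    using that
  proof (induction j)
    case (Suc j)
    then show ?case using L by (metis Suc_lessD less_Suc_eq less_trans)
  qed simp
  have "inj_on a {..<n}"
    by (rule inj_onI) (metis less lessThan_iff linorder_neqE_nat less_irrefl)
  then have "inj_on key {..<n}"
    using im by (metis card_image eq_card_imp_inj_on finite_lessThan)
  moreover have "- a i \<in> a ` {..<n}" if "i < n" for i
  proof -
    have "- a i = a (n - Suc i)" "n - Suc i \<in> {..<n}" using L that by (auto simp: add_eq_0_iff)
    then show ?thesis by simp
  qed
  then have "uminus ` a ` {..<n} \<subseteq> a ` {..<n}" by auto
  ultimately show ?R using im by simp
next
  assume R: ?R
  then have inj: "inj_on a {..<n}"
    using im by (metis card_image eq_card_imp_inj_on finite_lessThan)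
  have strict: "a i < a (Suc i)" if "Suc i < n" for i
    using mono_onD[OF mono, of i "Suc i"] inj_onD[OF inj, of i "Suc i"] that by fastforce
  let ?b = "\<lambda>i. - a (n - Suc i)"
  have bij: "bij_betw (\<lambda>i. n - Suc i) {..<n} {..<n}"
    by (rule bij_betwI[where g = "\<lambda>i. n - Suc i"]) auto
  then have b_im: "?b ` {..<n} = uminus ` a ` {..<n}"
    by (metis (no_types, lifting) bij_betw_imp_surj_on image_cong image_image)
  have "uminus ` a ` {..<n} = a ` {..<n}"
    using R im by (intro card_subset_eq) (auto simp: card_image)
  then have set: "set (map ?b [0..<n]) = set (map a [0..<n])"
    using b_im by (simp add: atLeast0LessThan)
  have "map ?b [0..<n] = map a [0..<n]"
  proof (rule sorted_distinct_set_unique)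
    show "sorted (map ?b [0..<n])" "sorted (map a [0..<n])"
      unfolding sorted_iff_nth_mono using mono_onD[OF mono] by auto
    show "distinct (map a [0..<n])" using inj by (simp add: distinct_map atLeast0LessThan)
    have "inj_on ?b {..<n}"
      using inj_onD[OF inj] by (auto intro!: inj_onI) (metis Suc_diff_Suc diff_Suc_less diff_diff_cancel less_imp_le_nat Suc_inject zero_less_iff_neq_zero not_less_zero)
    then show "distinct (map ?b [0..<n])" by (simp add: distinct_map atLeast0LessThan)
  qed (rule set)
  then have "?b i = a i" if "i < n" for i
    using that by (metis (no_types, lifting) map_eq_conv atLeastLessThan_iff atLeast_upt lessThan_iff set_upt zero_le)
  with strict show ?L by force
qed

lemma test_keys_correct:
  assumes s: "nats s ''n'' 0 = n" and a: "reals s ''a'' = a"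
  shows "achieves test_keys s (n * 60 + 20)
     (\<lambda>s'. nats s' ''ok'' 0 = 1 \<longleftrightarrow> nats s ''ok'' 0 = 1 \<and>
        (\<forall>i<n. (Suc i < n \<longrightarrow> a i < a (Suc i)) \<and> a i + a (n - Suc i) = 0))"
proof -
  define P where "P i \<longleftrightarrow> (Suc i < n \<longrightarrow> a i < a (Suc i)) \<and> a i + a (n - Suc i) = 0" for i
  let ?I = "\<lambda>j s'. nats s' ''ok'' 0 = 1 \<longleftrightarrow> nats s ''ok'' 0 = 1 \<and> (\<forall>i<j. P i)"
  obtain body where body: "test_keys = for_all_inputs body"
    "body = Seq (Cond (BAnd (NLess (NAdd (NVar ''i'') (NConst 1)) (NVar ''n''))
                (BNot (RLess (RLoad ''a'' (NVar ''i'')) (RLoad ''a'' (NAdd (NVar ''i'') (NConst 1))))))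
            (NSet ''ok'' (NConst 0)) Skip)
         (Cond (REq (RAdd (RLoad ''a'' (NVar ''i''))
                      (RLoad ''a'' (NSub (NVar ''n'') (NAdd (NVar ''i'') (NConst 1))))) (RConst 0))
            Skip (NSet ''ok'' (NConst 0)))"
    by (simp add: test_keys_def)
  have "achieves (for_all_inputs body) s (n * 60 + 20) (?I n)"
  proof (rule achieves_for_all_inputs[where I = ?I])
    fix j s' assume I: "?I j s'" and s': "nats s' ''i'' 0 = j" "nats s' ''n'' 0 = n"
      and fr: "frame (for_all_inputs body) s s'"
    have "reals s' ''a'' = a" using frameD(2)[OF fr, of "''a''"] a by (simp add: body(2))
    with s' have "nats (exec body s') ''ok'' 0 = 1 \<longleftrightarrow> nats s' ''ok'' 0 = 1 \<and> P j"
      by (simp add: body(2) P_def)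
    with I show "?I (Suc j) (nstore ''i'' 0 (Suc j) (exec body s'))"
      by (auto simp: All_less_Suc)
  qed (use s in \<open>auto simp: body(2)\<close>)
  then show ?thesis by (simp only: body(1) P_def)
qed

lemma pivot_pts_iff:
  assumes inj: "inj_on (pt X Y) {..<n}" and c: "c < n"
  defines "v \<equiv> unit_sum (pts X Y n) (pt X Y c)"
  defines "key \<equiv> \<lambda>i. slope v (pt X Y i - pt X Y c)"
  shows "pivot (pts X Y n) (pt X Y c) \<longleftrightarrow> (\<forall>i<n. i \<noteq> c \<longrightarrow> 0 < v \<bullet> (pt X Y i - pt X Y c)) \<and>
     inj_on key {..<n} \<and> uminus ` key ` {..<n} \<subseteq> key ` {..<n}"
proof -
  have "(\<forall>r\<in>pts X Y n - {pt X Y c}. 0 < v \<bullet> (r - pt X Y c)) \<longleftrightarrow>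
      (\<forall>i<n. i \<noteq> c \<longrightarrow> 0 < v \<bullet> (pt X Y i - pt X Y c))"
    using inj c by (auto simp: pts_def inj_on_def)
  moreover have "inj_on (\<lambda>r. slope v (r - pt X Y c)) (pts X Y n) \<longleftrightarrow> inj_on key {..<n}"
    unfolding pts_def key_def comp_inj_on_iff[OF inj] by (simp add: comp_def)
  moreover have "(\<lambda>r. slope v (r - pt X Y c)) ` pts X Y n = key ` {..<n}"
    by (simp add: pts_def key_def image_image)
  ultimately show ?thesis by (simp add: pivot_def Let_def v_def[symmetric])
qed

text \<open>Flags are only ever raised, so that they accumulate the results for all candidates.\<close>

definition mark :: "bool \<Rightarrow> nat \<Rightarrow> nat" where "mark b old = (if b then 1 else old)"

lemma check_candidate_correct:
  assumes s: "nats s ''n'' 0 = n" "nats s ''c'' 0 = c" "reals s ''x'' = X" "reals s ''y'' = Y"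
    and inj: "inj_on (pt X Y) {..<n}" and c: "c < n" and L: "n \<le> 2 ^ L"
  defines "T \<equiv> pts X Y n" and "p \<equiv> pt X Y c"
  shows "achieves check_candidate s (1000 * n * (L + 1))
     (\<lambda>s'. nats s' ''member'' 0 = mark (pivot T p) (nats s ''member'' 0) \<and>
           nats s' ''fw_at_pivot'' 0 =
             mark (pivot T p \<and> norm (unit_sum T p) \<le> 1) (nats s ''fw_at_pivot'' 0))"
proof -
  define v where "v = unit_sum T p"
  define key where "key i = slope v (pt X Y i - pt X Y c)" for i
  define front where "front \<longleftrightarrow> (\<forall>i<n. i \<noteq> c \<longrightarrow> 0 < v \<bullet> (pt X Y i - pt X Y c))"
  have norm: "norm v \<le> 1 \<longleftrightarrow> \<not> 1 < v $ 1 * v $ 1 + v $ 2 * v $ 2"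
    by (simp add: norm_vec_def L2_set_def sum_2 power2_eq_square not_less)
  show ?thesis
    unfolding check_candidate_def
  proof (rule achieves_Seq[OF sum_units_correct[OF s inj]])
    fix s1 assume "reals s1 ''u'' 0 = unit_sum (pts X Y n) (pt X Y c) $ 1 \<and>
        reals s1 ''v'' 0 = unit_sum (pts X Y n) (pt X Y c) $ 2" and fr1: "frame sum_units s s1"
    then have v1: "reals s1 ''u'' 0 = v $ 1" "reals s1 ''v'' 0 = v $ 2" by (simp_all add: v_def T_def p_def)
    note f1 = frameD[OF fr1, simplified]
    have s1: "nats s1 ''n'' 0 = n" "nats s1 ''c'' 0 = c" "reals s1 ''x'' = X" "reals s1 ''y'' = Y"
      "nats s1 ''member'' = nats s ''member''" "nats s1 ''fw_at_pivot'' = nats s ''fw_at_pivot''"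
      using f1 s by simp_all
    show "achieves (Seq compute_keys (Seq merge_sort (Seq test_keys report))) s1
      (n * 80 + 20 + (L * (600 * n + 46) + 9 + (n * 60 + 20 + 40)))
     (\<lambda>s'. nats s' ''member'' 0 = mark (pivot T p) (nats s ''member'' 0) \<and>
           nats s' ''fw_at_pivot'' 0 =
             mark (pivot T p \<and> norm (unit_sum T p) \<le> 1) (nats s ''fw_at_pivot'' 0))"
    proof (rule achieves_Seq[OF compute_keys_correct[OF s1(1-4) v1]])
      fix s2 assume k2: "(\<forall>i<n. reals s2 ''a'' i = slope v (pt X Y i - pt X Y c)) \<and>
           (nats s2 ''ok'' 0 = 1 \<longleftrightarrow> (\<forall>i<n. i \<noteq> c \<longrightarrow> 0 < v \<bullet> (pt X Y i - pt X Y c)))"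
        and fr2: "frame compute_keys s1 s2"
      note f2 = frameD[OF fr2, simplified]
      have s2: "nats s2 ''n'' 0 = n" "reals s2 ''u'' 0 = v $ 1" "reals s2 ''v'' 0 = v $ 2"
        "nats s2 ''member'' = nats s ''member''" "nats s2 ''fw_at_pivot'' = nats s ''fw_at_pivot''"
        using f2 s1 v1 by simp_all
      have a2: "reals s2 ''a'' ` {..<n} = key ` {..<n}"
        using k2 by (intro image_cong) (auto simp: key_def)
      show "achieves (Seq merge_sort (Seq test_keys report)) s2
         (L * (600 * n + 46) + 9 + (n * 60 + 20 + 40))
         (\<lambda>s'. nats s' ''member'' 0 = mark (pivot T p) (nats s ''member'' 0) \<and>
           nats s' ''fw_at_pivot'' 0 =
             mark (pivot T p \<and> norm (unit_sum T p) \<le> 1) (nats s ''fw_at_pivot'' 0))"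
      proof (rule achieves_Seq[OF merge_sort_correct[OF refl s2(1) L]])
        fix s3 assume a3: "reals s3 ''a'' ` {..<n} = reals s2 ''a'' ` {..<n} \<and>
            mono_on {..<n} (reals s3 ''a'')" and fr3: "frame merge_sort s2 s3"
        note f3 = frameD[OF fr3, simplified]
        have s3: "nats s3 ''n'' 0 = n" "reals s3 ''u'' 0 = v $ 1" "reals s3 ''v'' 0 = v $ 2"
          "nats s3 ''member'' = nats s ''member''" "nats s3 ''fw_at_pivot'' = nats s ''fw_at_pivot''"
          "nats s3 ''ok'' = nats s2 ''ok''"
          using f3 s2 by simp_all
        have sorted: "mono_on {..<n} (reals s3 ''a'')" "reals s3 ''a'' ` {..<n} = key ` {..<n}"
          using a3 a2 by auto
        show "achieves (Seq test_keys report) s3 (n * 60 + 20 + 40)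
         (\<lambda>s'. nats s' ''member'' 0 = mark (pivot T p) (nats s ''member'' 0) \<and>
           nats s' ''fw_at_pivot'' 0 =
             mark (pivot T p \<and> norm (unit_sum T p) \<le> 1) (nats s ''fw_at_pivot'' 0))"
        proof (rule achieves_Seq[OF test_keys_correct[OF s3(1) refl]])
          fix s4 assume ok: "nats s4 ''ok'' 0 = 1 \<longleftrightarrow> nats s3 ''ok'' 0 = 1 \<and>
            (\<forall>i<n. (Suc i < n \<longrightarrow> reals s3 ''a'' i < reals s3 ''a'' (Suc i)) \<and>
               reals s3 ''a'' i + reals s3 ''a'' (n - Suc i) = 0)"
            and fr4: "frame test_keys s3 s4"
          note f4 = frameD[OF fr4, simplified]
          have s4: "reals s4 ''u'' 0 = v $ 1" "reals s4 ''v'' 0 = v $ 2"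
            "nats s4 ''member'' = nats s ''member''" "nats s4 ''fw_at_pivot'' = nats s ''fw_at_pivot''"
            using f4 s3 by simp_all
          have "nats s4 ''ok'' 0 = 1 \<longleftrightarrow> pivot T p"
            using ok k2 unfolding strictly_sorted_and_odd_iff[OF sorted] s3(6) T_def p_def
              pivot_pts_iff[OF inj c] v_def[unfolded T_def p_def, symmetric] key_def by blast
          then show "achieves report s4 40
             (\<lambda>s'. nats s' ''member'' 0 = mark (pivot T p) (nats s ''member'' 0) \<and>
               nats s' ''fw_at_pivot'' 0 =
                 mark (pivot T p \<and> norm (unit_sum T p) \<le> 1) (nats s ''fw_at_pivot'' 0))"
            using s4 norm unfolding v_def[symmetric]
            by (intro achieves_exec) (auto simp: report_def mark_def)
        qed simp
      qed simp
    qed simp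
  next
    have "1 \<le> n" using c by simp
    then have "L \<le> n * L" by simp
    have "n * 70 + 20 + (n * 80 + 20 + (L * (600 * n + 46) + 9 + (n * 60 + 20 + 40))) =
        210 * n + 109 + 600 * (n * L) + 46 * L" by (simp add: algebra_simps)
    also have "\<dots> \<le> 1000 * (n * L) + 1000 * n" using \<open>1 \<le> n\<close> \<open>L \<le> n * L\<close> by linarith
    also have "\<dots> = 1000 * n * (L + 1)" by (simp add: algebra_simps)
    finally show "n * 70 + 20 + (n * 80 + 20 + (L * (600 * n + 46) + 9 + (n * 60 + 20 + 40)))
        \<le> 1000 * n * (L + 1)" .
  qed
qed

section \<open>Candidates along the lower hull\<close>

definition lex_positive :: "real^2 \<Rightarrow> bool" where
  "lex_positive w \<longleftrightarrow> 0 < w $ 1 \<or> w $ 1 = 0 \<and> 0 < w $ 2"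

lemma lex_positive_add: "lex_positive u \<Longrightarrow> lex_positive v \<Longrightarrow> lex_positive (u + v)"
  by (auto simp: lex_positive_def)

lemma lex_positive_total: "u \<noteq> 0 \<Longrightarrow> \<not> lex_positive u \<Longrightarrow> lex_positive (- u)"
  by (auto simp: lex_positive_def vec_eq_iff forall_2)

lemma not_lex_positive_zero [simp]: "\<not> lex_positive 0"
  by (simp add: lex_positive_def)

lemma cross2_self [simp]: "cross2 u u = 0"
  by (simp add: cross2_def)

lemma cross2_flip: "cross2 v u = - cross2 u v"
  by (simp add: cross2_def)

lemma cross2_diff: "cross2 u (v - w) = cross2 u v - cross2 u w" "cross2 (v - w) u = cross2 v u - cross2 w u"
  "cross2 u (- v) = - cross2 u v" "cross2 (- v) u = - cross2 v u"
  by (simp_all add: cross2_def algebra_simps)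

text \<open>Among lexicographically positive vectors, \<open>0 \<le> cross2 d a\<close> compares slopes with respect to the
horizontal axis, the upward vertical direction counting as the greatest slope.  The comparison is
therefore transitive.\<close>

lemma cross2_trans:
  assumes a: "lex_positive a" and b: "lex_positive b" and d: "lex_positive d" and da: "0 \<le> cross2 d a" and ab: "0 \<le> cross2 a b"
  shows "0 \<le> cross2 d b" "0 < cross2 d a \<or> 0 < cross2 a b \<Longrightarrow> 0 < cross2 d b"
proof -
  have nonneg: "0 \<le> a $ 1" "0 \<le> b $ 1" "0 \<le> d $ 1" using a b d by (auto simp: lex_positive_def)
  have eq: "a $ 1 * cross2 d b = b $ 1 * cross2 d a + d $ 1 * cross2 a b"
    by (simp add: cross2_def algebra_simps)
  have both: "0 \<le> cross2 d b \<and> (0 < cross2 d a \<or> 0 < cross2 a b \<longrightarrow> 0 < cross2 d b)"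
  proof (cases "a $ 1 = 0")
    case True
    then have a2: "0 < a $ 2" using a by (auto simp: lex_positive_def)
    then have "b $ 1 = 0" using ab True nonneg by (simp add: cross2_def mult_le_0_iff)
    moreover from this have "0 < b $ 2" using b by (auto simp: lex_positive_def)
    ultimately show ?thesis using a2 True nonneg by (simp add: cross2_def zero_less_mult_iff)
  next
    case False
    then have a1: "0 < a $ 1" using nonneg by simp
    have "0 \<le> a $ 1 * cross2 d b" unfolding eq using da ab nonneg by simp
    then have "0 \<le> cross2 d b" using a1 by (simp add: zero_le_mult_iff)
    moreover have "0 < cross2 d b" if "0 < cross2 d a \<or> 0 < cross2 a b"
    proof (cases "0 < cross2 a b \<and> 0 < d $ 1 \<or> 0 < cross2 d a \<and> 0 < b $ 1")
      case True
      then have "0 < a $ 1 * cross2 d b" unfolding eq using da ab nonneg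
        by (auto intro: add_pos_nonneg add_nonneg_pos)
      then show ?thesis using a1 by (simp add: zero_less_mult_iff)
    next
      case False
      show ?thesis
      proof (cases "d $ 1 = 0")
        case True
        then have "0 < d $ 2" using d by (auto simp: lex_positive_def)
        then have "cross2 d a < 0" using True a1 by (simp add: cross2_def)
        then show ?thesis using da by simp
      next
        case d1: False
        then have "b $ 1 = 0" using False that nonneg by force
        then have "0 < b $ 2" using b by (auto simp: lex_positive_def)
        then show ?thesis using \<open>b $ 1 = 0\<close> d1 nonneg by (simp add: cross2_def)
      qed
    qed
    ultimately show ?thesis by blast
  qed
  then show "0 \<le> cross2 d b" "0 < cross2 d a \<or> 0 < cross2 a b \<Longrightarrow> 0 < cross2 d b" by blast+
qed

definition lex_less :: "(nat \<Rightarrow> real) \<Rightarrow> (nat \<Rightarrow> real) \<Rightarrow> nat \<Rightarrow> nat \<Rightarrow> bool" where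
  "lex_less X Y i j \<longleftrightarrow> lex_positive (pt X Y j - pt X Y i)"

lemma lex_less_trans: "lex_less X Y i j \<Longrightarrow> lex_less X Y j k \<Longrightarrow> lex_less X Y i k"
  using lex_positive_add[of "pt X Y j - pt X Y i" "pt X Y k - pt X Y j"] by (simp add: lex_less_def)

lemma lex_less_irrefl [simp]: "\<not> lex_less X Y i i"
  by (simp add: lex_less_def)

lemma lex_less_total:
  "inj_on (pt X Y) {..<n} \<Longrightarrow> i < n \<Longrightarrow> j < n \<Longrightarrow> i \<noteq> j \<Longrightarrow> lex_less X Y i j \<or> lex_less X Y j i"
  using lex_positive_total[of "pt X Y j - pt X Y i"] by (auto simp: lex_less_def dest: inj_onD)

text \<open>Among the points lexicographically greater than \<open>c\<close>, the next one has the least slope as seen from \<open>c\<close>, and is the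
farthest among those of equal slope.  The default \<open>q = c\<close> signals that there is no such point.\<close>

definition next_on_chain :: "(nat \<Rightarrow> real) \<Rightarrow> (nat \<Rightarrow> real) \<Rightarrow> nat \<Rightarrow> nat \<Rightarrow> nat \<Rightarrow> bool" where
  "next_on_chain X Y n c q \<longleftrightarrow> (\<forall>i<n. lex_less X Y c i \<longrightarrow> q \<noteq> c \<and>
     (let z = pt X Y q - pt X Y c; y = pt X Y i - pt X Y c in
      0 \<le> cross2 z y \<and> (cross2 z y = 0 \<longrightarrow> \<not> lex_less X Y q i))) \<and> (q = c \<or> lex_less X Y c q)"

definition better :: "(nat \<Rightarrow> real) \<Rightarrow> (nat \<Rightarrow> real) \<Rightarrow> nat \<Rightarrow> nat \<Rightarrow> nat \<Rightarrow> bool" where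
  "better X Y c q i \<longleftrightarrow> lex_less X Y c i \<and> (q = c \<or>
     (let t = cross2 (pt X Y q - pt X Y c) (pt X Y i - pt X Y c) in t < 0 \<or> t = 0 \<and> lex_less X Y q i))"

lemma next_on_chain_Suc:
  assumes N: "next_on_chain X Y j c q"
  shows "next_on_chain X Y (Suc j) c (if better X Y c q j then j else q)"
proof (cases "better X Y c q j")
  case False
  then show ?thesis using N
    by (auto simp: next_on_chain_def better_def less_Suc_eq Let_def not_less)
next
  case True
  then have cj: "lex_less X Y c j" by (simp add: better_def)
  have "j \<noteq> c" using cj by auto
  moreover have "0 \<le> cross2 (pt X Y j - pt X Y c) (pt X Y i - pt X Y c) \<and>
      (cross2 (pt X Y j - pt X Y c) (pt X Y i - pt X Y c) = 0 \<longrightarrow> \<not> lex_less X Y j i)"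
    if "i < Suc j" "lex_less X Y c i" for i
  proof (cases "i = j")
    case False
    then have "i < j" using that by simp
    let ?z = "pt X Y q - pt X Y c" and ?y = "pt X Y i - pt X Y c" and ?d = "pt X Y j - pt X Y c"
    have qc: "q \<noteq> c" and zy: "0 \<le> cross2 ?z ?y" "cross2 ?z ?y = 0 \<longrightarrow> \<not> lex_less X Y q i" and "lex_less X Y c q"
      using N \<open>i < j\<close> that(2) by (auto simp: next_on_chain_def Let_def)
    then have pos: "lex_positive ?z" "lex_positive ?y" "lex_positive ?d" using that(2) cj by (auto simp: lex_less_def)
    have "cross2 ?z ?d < 0 \<or> cross2 ?z ?d = 0 \<and> lex_less X Y q j"
      using True qc by (auto simp: better_def Let_def)
    then have dz: "0 \<le> cross2 ?d ?z" "0 < cross2 ?d ?z \<or> lex_less X Y q j"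
      using cross2_flip[of ?d ?z] by auto
    note trans = cross2_trans[OF pos dz(1) zy(1)]
    have "\<not> lex_less X Y j i" if "cross2 ?d ?y = 0"
    proof -
      have "\<not> 0 < cross2 ?d ?z" "\<not> 0 < cross2 ?z ?y" using trans(2) that by auto
      then have "lex_less X Y q j" "\<not> lex_less X Y q i" using dz zy by auto
      then show ?thesis using lex_less_trans by blast
    qed
    then show ?thesis using trans(1) by simp
  qed simp
  ultimately show ?thesis using True cj by (simp add: next_on_chain_def Let_def)
qed

text \<open>\<open>w\<close> is the direction of the edge along which the walk arrived at \<open>c\<close>.\<close>

definition entered :: "(nat \<Rightarrow> real) \<Rightarrow> (nat \<Rightarrow> real) \<Rightarrow> nat \<Rightarrow> nat \<Rightarrow> bool" where
  "entered X Y n c \<longleftrightarrow> (\<exists>w. lex_positive w \<and> (\<forall>i<n.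
     (lex_less X Y c i \<longrightarrow> 0 < cross2 w (pt X Y i - pt X Y c)) \<and>
     (lex_less X Y i c \<longrightarrow> 0 \<le> cross2 w (pt X Y i - pt X Y c))))"

definition leftmost :: "(nat \<Rightarrow> real) \<Rightarrow> (nat \<Rightarrow> real) \<Rightarrow> nat \<Rightarrow> nat \<Rightarrow> bool" where
  "leftmost X Y n c \<longleftrightarrow> (\<forall>i<n. \<not> lex_less X Y i c)"

definition separates :: "real^2 \<Rightarrow> (nat \<Rightarrow> real) \<Rightarrow> (nat \<Rightarrow> real) \<Rightarrow> nat \<Rightarrow> nat \<Rightarrow> bool" where
  "separates f X Y n e \<longleftrightarrow> (\<forall>j<n. j \<noteq> e \<longrightarrow> 0 < f \<bullet> (pt X Y j - pt X Y e))"

definition exposed :: "(nat \<Rightarrow> real) \<Rightarrow> (nat \<Rightarrow> real) \<Rightarrow> nat \<Rightarrow> nat \<Rightarrow> bool" where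
  "exposed X Y n e \<longleftrightarrow> (\<exists>f. separates f X Y n e)"

definition exposed_below :: "(nat \<Rightarrow> real) \<Rightarrow> (nat \<Rightarrow> real) \<Rightarrow> nat \<Rightarrow> nat \<Rightarrow> bool" where
  "exposed_below X Y n e \<longleftrightarrow> (\<exists>f. 0 \<le> f $ 2 \<and> separates f X Y n e)"

text \<open>Here \<open>w\<close> is the edge entering a point of the chain, \<open>z\<close> the edge leaving it, and \<open>y\<close> points to the
left: slopes along the chain increase, so a point to the left that is above the line of \<open>w\<close> is above
the line of \<open>z\<close>.\<close>

lemma chain_keeps_below_edge:
  assumes w: "lex_positive w" and z: "lex_positive z" and wz: "0 < cross2 w z"
    and y: "lex_positive (- y)" and wy: "0 \<le> cross2 w y"
  shows "0 < cross2 z y"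
proof -
  have "0 \<le> cross2 (- y) w" using wy cross2_flip[of w y] by (simp add: cross2_diff)
  from cross2_trans(2)[OF w z y this] wz have "0 < cross2 (- y) z" by simp
  then show ?thesis using cross2_flip[of y z] by (simp add: cross2_diff)
qed

text \<open>Every point of the input is on or above the line of the new edge: the points to the right of \<open>c\<close> by
the choice of \<open>q\<close>, those to the left by the previous edge.  A point between two edges of the chain is
exposed by the sum of the normals of the two edges; it is strictly minimal because each
normal is strict on one side.\<close>

lemma chain_step:
  assumes inj: "inj_on (pt X Y) {..<n}" and c: "c < n" and q: "q < n" "q \<noteq> c"
    and N: "next_on_chain X Y n c q" and start: "leftmost X Y n c \<or> entered X Y n c"
  shows "entered X Y n q" "leftmost X Y n c \<or> exposed X Y n c"
proof -
  let ?z = "pt X Y q - pt X Y c"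
  have cq: "lex_less X Y c q" using N q by (auto simp: next_on_chain_def)
  then have z: "lex_positive ?z" by (simp add: lex_less_def)
  have above: "0 \<le> cross2 ?z (pt X Y i - pt X Y c)"
    "cross2 ?z (pt X Y i - pt X Y c) = 0 \<Longrightarrow> \<not> lex_less X Y q i" if "i < n" "lex_less X Y c i" for i
    using N that by (auto simp: next_on_chain_def Let_def)
  have before: "0 < cross2 ?z (pt X Y i - pt X Y c)" if i: "i < n" "lex_less X Y i c" for i
  proof -
    have "entered X Y n c" using start i by (auto simp: leftmost_def)
    then obtain w where "lex_positive w" "0 < cross2 w ?z" "0 \<le> cross2 w (pt X Y i - pt X Y c)"
      using i q cq unfolding entered_def by blast
    then show ?thesis using i z by (auto simp: lex_less_def intro: chain_keeps_below_edge[of w])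
  qed
  have shift: "cross2 ?z (pt X Y i - pt X Y q) = cross2 ?z (pt X Y i - pt X Y c)" for i
    by (simp add: cross2_def algebra_simps)
  show "entered X Y n q"
    unfolding entered_def
  proof (intro exI[of _ ?z] conjI allI impI)
    fix i assume i: "i < n"
    show "0 < cross2 ?z (pt X Y i - pt X Y q)" if "lex_less X Y q i"
      using above[OF i lex_less_trans[OF cq that]] that unfolding shift by linarith
    show "0 \<le> cross2 ?z (pt X Y i - pt X Y q)" if "lex_less X Y i q"
    proof (cases "i = c")
      case False
      then show ?thesis
        using lex_less_total[OF inj i c] above(1)[OF i] before[OF i] unfolding shift
        by (blast intro: less_imp_le)
    qed (simp add: shift, simp add: cross2_def)
  qed (rule z)
  show "leftmost X Y n c \<or> exposed X Y n c"
  proof (cases "leftmost X Y n c")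
    case False
    then obtain w where w: "lex_positive w" "\<And>i. i < n \<Longrightarrow> lex_less X Y c i \<Longrightarrow> 0 < cross2 w (pt X Y i - pt X Y c)"
      "\<And>i. i < n \<Longrightarrow> lex_less X Y i c \<Longrightarrow> 0 \<le> cross2 w (pt X Y i - pt X Y c)"
      using start unfolding entered_def by blast
    have inner: "perp u \<bullet> y = cross2 u y" for u y
      by (simp add: perp_def cross2_def inner_vec_def sum_2)
    have "separates (perp w + perp ?z) X Y n c"
      unfolding separates_def inner_add_left inner
    proof (intro allI impI)
      fix i assume "i < n" "i \<noteq> c"
      with lex_less_total[OF inj this(1) c] w(2,3)[of i] above(1)[of i] before[of i]
      show "0 < cross2 w (pt X Y i - pt X Y c) + cross2 ?z (pt X Y i - pt X Y c)"
        by (auto intro: add_pos_nonneg add_nonneg_pos)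
    qed
    then show ?thesis by (auto simp: exposed_def)
  qed simp
qed

text \<open>Let \<open>u\<close> and \<open>v\<close> lead from \<open>c\<close> to \<open>e\<close> and from \<open>e\<close> to \<open>q\<close>.  A function that is minimal at \<open>e\<close> alone
decreases along \<open>u\<close> and increases along \<open>v\<close>.  Since \<open>e\<close> is not below the edge, \<open>u\<close> is at
least as steep as \<open>v\<close>; a linear function with nonnegative second coefficient cannot behave that way.\<close>

lemma chain_skips_none:
  assumes c: "c < n" and q: "q < n"
    and N: "next_on_chain X Y n c q" and e: "e < n" "exposed_below X Y n e" and ce: "lex_less X Y c e"
  shows "\<not> lex_less X Y e q"
proof
  assume eq: "lex_less X Y e q"
  obtain f where f: "0 \<le> f $ 2" "separates f X Y n e" using e(2) by (auto simp: exposed_below_def)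
  define u v where "u = pt X Y e - pt X Y c" and "v = pt X Y q - pt X Y e"
  have pos: "lex_positive u" "lex_positive v" using ce eq by (auto simp: u_def v_def lex_less_def)
  have "c \<noteq> e" "q \<noteq> e" using ce eq by auto
  then have "0 < f \<bullet> v" "0 < f \<bullet> (pt X Y c - pt X Y e)"
    using f(2) c q by (auto simp: separates_def v_def)
  moreover have "f \<bullet> (pt X Y c - pt X Y e) = - (f \<bullet> u)"
    by (simp add: u_def inner_diff_right)
  ultimately have fu: "f \<bullet> u < 0" and fv: "0 < f \<bullet> v" by simp_all
  have "0 \<le> cross2 (pt X Y q - pt X Y c) u"
    using N e(1) ce by (auto simp: next_on_chain_def Let_def u_def)
  then have "0 \<le> cross2 v u"
    by (simp add: u_def v_def cross2_def algebra_simps)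
  then have "0 \<le> f $ 2 * cross2 v u" using f(1) by simp
  moreover have "f $ 2 * cross2 v u = v $ 1 * (f \<bullet> u) - u $ 1 * (f \<bullet> v)"
    by (simp add: cross2_def inner_vec_def sum_2 algebra_simps)
  moreover have nonneg: "0 \<le> u $ 1" "0 \<le> v $ 1" using pos by (auto simp: lex_positive_def)
  moreover have "v $ 1 * (f \<bullet> u) \<le> 0" "0 \<le> u $ 1 * (f \<bullet> v)"
    using nonneg fu fv by (auto simp: mult_le_0_iff)
  ultimately have "u $ 1 * (f \<bullet> v) = 0" by linarith
  then have "u $ 1 = 0" using fv by simp
  then have "0 < u $ 2" "f \<bullet> u = f $ 2 * u $ 2" using pos by (auto simp: lex_positive_def inner_vec_def sum_2)
  then show False using fu f(1) by (simp add: mult_less_0_iff)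
qed

abbreviation BOr :: "bexp \<Rightarrow> bexp \<Rightarrow> bexp" where
  "BOr a b \<equiv> BNot (BAnd (BNot a) (BNot b))"

definition lex_test :: "nexp \<Rightarrow> nexp \<Rightarrow> bexp" where
  "lex_test i j = BOr (RLess (RLoad ''x'' i) (RLoad ''x'' j))
     (BAnd (REq (RLoad ''x'' i) (RLoad ''x'' j)) (RLess (RLoad ''y'' i) (RLoad ''y'' j)))"

definition turn :: rexp where
  "turn = RSub
     (RMul (RSub (RLoad ''x'' (NVar ''q'')) (RLoad ''x'' (NVar ''c'')))
           (RSub (RLoad ''y'' (NVar ''i'')) (RLoad ''y'' (NVar ''c''))))
     (RMul (RSub (RLoad ''y'' (NVar ''q'')) (RLoad ''y'' (NVar ''c'')))
           (RSub (RLoad ''x'' (NVar ''i'')) (RLoad ''x'' (NVar ''c''))))"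

lemma bval_lex_test [simp]:
  "bval (lex_test i j) s \<longleftrightarrow> lex_less (reals s ''x'') (reals s ''y'') (nval i s) (nval j s)"
  by (auto simp: lex_test_def lex_less_def lex_positive_def)

definition find_leftmost :: com where
  "find_leftmost = Seq (NSet ''c'' (NConst 0))
     (for_all_inputs (Cond (lex_test (NVar ''i'') (NVar ''c'')) (NSet ''c'' (NVar ''i'')) Skip))"

definition find_next :: com where
  "find_next = Seq (NSet ''q'' (NVar ''c''))
     (for_all_inputs
       (Cond (BAnd (lex_test (NVar ''c'') (NVar ''i''))
           (BOr (NEq (NVar ''q'') (NVar ''c''))
             (BOr (RLess turn (RConst 0))
               (BAnd (REq turn (RConst 0)) (lex_test (NVar ''q'') (NVar ''i''))))))
         (NSet ''q'' (NVar ''i'')) Skip))"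

definition walk_step :: com where
  "walk_step = Seq check_candidate (Seq find_next
     (Cond (NEq (NVar ''q'') (NVar ''c'')) (NSet ''done'' (NConst 1)) (NSet ''c'' (NVar ''q''))))"

definition walk_lower_hull :: com where
  "walk_lower_hull = Seq (NSet ''done'' (NConst 0)) (Seq find_leftmost
     (Loop (NEq (NVar ''done'') (NConst 0)) walk_step))"

lemma mods_walk [simp]:
  "nmods find_leftmost = {''c'', ''i''}" "rmods find_leftmost = {}"
  "nmods find_next = {''q'', ''i''}" "rmods find_next = {}"
  by (auto simp: find_leftmost_def find_next_def)

lemma mods_walk_step [simp]:
  "nmods walk_step = insert ''done'' (insert ''c'' (insert ''q'' (nmods check_candidate)))"
  "rmods walk_step = rmods check_candidate"
  by (auto simp: walk_step_def)

lemma mods_walk_lower_hull [simp]: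
  "nmods walk_lower_hull = nmods walk_step" "rmods walk_lower_hull = rmods walk_step"
  by (auto simp: walk_lower_hull_def)

lemma find_leftmost_correct:
  assumes s: "nats s ''n'' 0 = n" "reals s ''x'' = X" "reals s ''y'' = Y" and "0 < n"
  shows "achieves find_leftmost s (n * 100 + 20)
    (\<lambda>s'. nats s' ''c'' 0 < n \<and> leftmost X Y n (nats s' ''c'' 0))"
  unfolding find_leftmost_def
proof (rule achieves_Seq_exec)
  let ?c = "Cond (lex_test (NVar ''i'') (NVar ''c'')) (NSet ''c'' (NVar ''i'')) Skip"
  let ?s = "exec (NSet ''c'' (NConst 0)) s"
  let ?I = "\<lambda>j s'. nats s' ''c'' 0 < n \<and> leftmost X Y j (nats s' ''c'' 0)"
  show "achieves (for_all_inputs ?c) ?s (n * 100 + 10) (?I n)"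
  proof (rule achieves_for_all_inputs[where I = ?I])
    fix j s' assume I: "?I j s'" and j: "j < n" "nats s' ''i'' 0 = j"
      and fr: "frame (for_all_inputs ?c) ?s s'"
    have "reals s' ''x'' = X" "reals s' ''y'' = Y"
      using frameD(2)[OF fr, of "''x''"] frameD(2)[OF fr, of "''y''"] s by simp_all
    moreover have step: "leftmost X Y (Suc j) (if lex_less X Y j c then j else c)" if "leftmost X Y j c" for c
      using that lex_less_trans by (fastforce simp: leftmost_def less_Suc_eq)
    ultimately have "nats (exec ?c s') ''c'' 0 =
        (if lex_less X Y j (nats s' ''c'' 0) then j else nats s' ''c'' 0)"
      using j by simp
    with I j step[of "nats s' ''c'' 0"]
    show "?I (Suc j) (nstore ''i'' 0 (Suc j) (exec ?c s'))"
      by (simp del: exec.simps split: if_splits)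
  qed (use s \<open>0 < n\<close> in \<open>auto simp: leftmost_def lex_test_def\<close>)
qed auto

lemma find_next_correct:
  assumes s: "nats s ''n'' 0 = n" "nats s ''c'' 0 = c" "reals s ''x'' = X" "reals s ''y'' = Y" and c: "c < n"
  shows "achieves find_next s (n * 200 + 20)
    (\<lambda>s'. nats s' ''q'' 0 < n \<and> next_on_chain X Y n c (nats s' ''q'' 0))"
  unfolding find_next_def
proof (rule achieves_Seq_exec)
  let ?c = "Cond (BAnd (lex_test (NVar ''c'') (NVar ''i''))
           (BOr (NEq (NVar ''q'') (NVar ''c''))
             (BOr (RLess turn (RConst 0))
               (BAnd (REq turn (RConst 0)) (lex_test (NVar ''q'') (NVar ''i''))))))
         (NSet ''q'' (NVar ''i'')) Skip"
  let ?s = "exec (NSet ''q'' (NVar ''c'')) s"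
  let ?I = "\<lambda>j s'. nats s' ''q'' 0 < n \<and> next_on_chain X Y j c (nats s' ''q'' 0)"
  show "achieves (for_all_inputs ?c) ?s (n * 200 + 10) (?I n)"
  proof (rule achieves_for_all_inputs[where I = ?I])
    fix j s' assume I: "?I j s'" and j: "j < n" "nats s' ''i'' 0 = j"
      and fr: "frame (for_all_inputs ?c) ?s s'"
    have v: "reals s' ''x'' = X" "reals s' ''y'' = Y" "nats s' ''c'' 0 = c"
      using frameD(2)[OF fr, of "''x''"] frameD(2)[OF fr, of "''y''"] frameD(1)[OF fr, of "''c''"] s
      by simp_all
    have "nats (exec ?c s') ''q'' 0 =
        (if better X Y c (nats s' ''q'' 0) j then j else nats s' ''q'' 0)"
      using v j by (auto simp: better_def turn_def cross2_def Let_def)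
    with I j next_on_chain_Suc[of X Y j c "nats s' ''q'' 0"]
    show "?I (Suc j) (nstore ''i'' 0 (Suc j) (exec ?c s'))"
      by (simp del: exec.simps split: if_splits)
  qed (use s c in \<open>auto simp: next_on_chain_def lex_test_def turn_def\<close>)
qed (use s in auto)

text \<open>The flag changes from \<open>old\<close> to \<open>new\<close> while the points satisfying \<open>D\<close> are examined.  Raising it is
always justified by some point with \<open>G\<close>, and points exposed from below are not missed.  Points
that are not exposed from below may or may not be visited.\<close>

definition flag_covers ::
  "(nat \<Rightarrow> real) \<Rightarrow> (nat \<Rightarrow> real) \<Rightarrow> nat \<Rightarrow> (nat \<Rightarrow> bool) \<Rightarrow> nat \<Rightarrow> (nat \<Rightarrow> bool) \<Rightarrow> nat \<Rightarrow> bool" where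
  "flag_covers X Y n G old D new \<longleftrightarrow> (new = 1 \<longrightarrow> old = 1 \<or> (\<exists>i<n. G i)) \<and> (old = 1 \<longrightarrow> new = 1) \<and>
     (\<forall>e<n. exposed_below X Y n e \<and> G e \<and> D e \<longrightarrow> new = 1)"

lemma flag_covers_mark:
  assumes "flag_covers X Y n G old D new" "c < n"
    and "\<And>e. e < n \<Longrightarrow> exposed_below X Y n e \<Longrightarrow> D' e \<Longrightarrow> D e \<or> e = c"
  shows "flag_covers X Y n G old D' (mark (G c) new)"
  using assms by (fastforce simp: flag_covers_def mark_def)

lemma walk_step_correct:
  assumes s: "nats s ''n'' 0 = n" "nats s ''c'' 0 = c" "reals s ''x'' = X" "reals s ''y'' = Y"
    and inj: "inj_on (pt X Y) {..<n}" and c: "c < n" and L: "n \<le> 2 ^ L"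
  defines "T \<equiv> pts X Y n" and "p \<equiv> pt X Y c"
  shows "achieves walk_step s (1500 * n * (L + 1))
     (\<lambda>s'. nats s' ''member'' 0 = mark (pivot T p) (nats s ''member'' 0) \<and>
           nats s' ''fw_at_pivot'' 0 =
             mark (pivot T p \<and> norm (unit_sum T p) \<le> 1) (nats s ''fw_at_pivot'' 0) \<and>
           (\<exists>q<n. next_on_chain X Y n c q \<and>
              (if q = c then nats s' ''c'' 0 = c \<and> nats s' ''done'' 0 = 1
               else nats s' ''c'' 0 = q \<and> nats s' ''done'' = nats s ''done'')))"
    (is "achieves _ _ _ ?Q")
  unfolding walk_step_def
proof (rule achieves_Seq[OF check_candidate_correct[OF s inj c L]])
  fix s1
  assume flags: "nats s1 ''member'' 0 = mark (pivot (pts X Y n) (pt X Y c)) (nats s ''member'' 0) \<and>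
     nats s1 ''fw_at_pivot'' 0 = mark (pivot (pts X Y n) (pt X Y c) \<and>
       norm (unit_sum (pts X Y n) (pt X Y c)) \<le> 1) (nats s ''fw_at_pivot'' 0)"
    and "frame check_candidate s s1"
  note f1 = frameD[OF this(2), simplified]
  have s1: "nats s1 ''n'' 0 = n" "nats s1 ''c'' 0 = c" "reals s1 ''x'' = X" "reals s1 ''y'' = Y"
    "nats s1 ''done'' = nats s ''done''"
    using f1 s by simp_all
  show "achieves (Seq find_next (Cond (NEq (NVar ''q'') (NVar ''c''))
      (NSet ''done'' (NConst 1)) (NSet ''c'' (NVar ''q'')))) s1 (n * 200 + 20 + 20) ?Q"
  proof (rule achieves_Seq[OF find_next_correct[OF s1(1-4) c]])
    fix s2 assume q: "nats s2 ''q'' 0 < n \<and> next_on_chain X Y n c (nats s2 ''q'' 0)"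
      and "frame find_next s1 s2"
    note f2 = frameD[OF this(2), simplified]
    have s2: "nats s2 ''c'' 0 = c" "nats s2 ''done'' = nats s ''done''"
      "nats s2 ''member'' = nats s1 ''member''" "nats s2 ''fw_at_pivot'' = nats s1 ''fw_at_pivot''"
      using f2 s1 by simp_all
    show "achieves (Cond (NEq (NVar ''q'') (NVar ''c''))
        (NSet ''done'' (NConst 1)) (NSet ''c'' (NVar ''q''))) s2 20 ?Q"
      using flags q s2 by (intro achieves_exec) (auto simp: T_def p_def)
  qed simp
next
  have "1 \<le> n" using c by simp
  then have "n * 200 + 40 \<le> 240 * n" by simp
  also have "\<dots> \<le> 500 * n * (L + 1)" by (simp add: algebra_simps)
  finally show "1000 * n * (L + 1) + (n * 200 + 20 + 20) \<le> 1500 * n * (L + 1)"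
    by (simp add: algebra_simps)
qed

text \<open>The number of iterations is bounded by a potential: the number of exposed points not yet passed,
plus one while the walk is at its start and plus one while it has not ended.  An iteration that
moves on from the start clears the first extra unit, the last iteration clears the second, and every
other iteration passes an exposed point.\<close>

lemma walk_lower_hull_correct:
  assumes s: "nats s ''n'' 0 = n" "reals s ''x'' = X" "reals s ''y'' = Y"
    and inj: "inj_on (pt X Y) {..<n}" and n: "0 < n" and L: "n \<le> 2 ^ L"
  defines "T \<equiv> pts X Y n"
  defines "G \<equiv> \<lambda>e. pivot T (pt X Y e)"
  defines "F \<equiv> \<lambda>e. pivot T (pt X Y e) \<and> norm (unit_sum T (pt X Y e)) \<le> 1"
  defines "H \<equiv> card {e. e < n \<and> exposed X Y n e}"
  shows "achieves walk_lower_hull s (3000 * (H + 2) * n * (L + 1))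
     (\<lambda>s'. flag_covers X Y n G (nats s ''member'' 0) (\<lambda>_. True) (nats s' ''member'' 0) \<and>
           flag_covers X Y n F (nats s ''fw_at_pivot'' 0) (\<lambda>_. True) (nats s' ''fw_at_pivot'' 0))"
    (is "achieves _ _ _ ?Q")
proof -
  define pot where "pot c d = card {e. e < n \<and> exposed X Y n e \<and> \<not> lex_less X Y e c} +
     (if leftmost X Y n c then 1 else 0) + (if d = (0::nat) then 1 else 0)" for c d
  define I where "I j s' \<longleftrightarrow> (\<exists>c<n. nats s' ''c'' 0 = c \<and> (leftmost X Y n c \<or> entered X Y n c) \<and>
      pot c (nats s' ''done'' 0) \<le> j \<and>
      flag_covers X Y n G (nats s ''member'' 0) (\<lambda>e. lex_less X Y e c \<or> nats s' ''done'' 0 \<noteq> 0)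
        (nats s' ''member'' 0) \<and>
      flag_covers X Y n F (nats s ''fw_at_pivot'' 0) (\<lambda>e. lex_less X Y e c \<or> nats s' ''done'' 0 \<noteq> 0)
        (nats s' ''fw_at_pivot'' 0))" for j and s' :: state
  let ?B = "1500 * n * (L + 1)"
  have loop: "achieves (Loop (NEq (NVar ''done'') (NConst 0)) walk_step) s1
      ((H + 2) * (?B + 5) + 5) ?Q"
    if s1: "nats s1 ''n'' 0 = n" "reals s1 ''x'' = X" "reals s1 ''y'' = Y" "nats s1 ''done'' 0 = 0"
      "nats s1 ''member'' = nats s ''member''" "nats s1 ''fw_at_pivot'' = nats s ''fw_at_pivot''"
      and c: "nats s1 ''c'' 0 < n" "leftmost X Y n (nats s1 ''c'' 0)" for s1
  proof (rule achieves_Loop[where I = I and N = "H + 2" and B = ?B])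
    have "card {e. e < n \<and> exposed X Y n e \<and> \<not> lex_less X Y e (nats s1 ''c'' 0)} \<le> H"
      unfolding H_def by (intro card_mono) auto
    then show "I (H + 2) s1"
      using s1 c by (auto simp: I_def pot_def flag_covers_def leftmost_def)
  next
    fix j s2 assume "I j s2" and fr: "frame walk_step s1 s2"
      and "bval (NEq (NVar ''done'') (NConst 0)) s2"
    then have going: "nats s2 ''done'' 0 = 0" by simp
    obtain c where c: "c < n" "nats s2 ''c'' 0 = c" and edge: "leftmost X Y n c \<or> entered X Y n c"
      and pot: "pot c 0 \<le> j"
      and flags: "flag_covers X Y n G (nats s ''member'' 0) (\<lambda>e. lex_less X Y e c) (nats s2 ''member'' 0)"
        "flag_covers X Y n F (nats s ''fw_at_pivot'' 0) (\<lambda>e. lex_less X Y e c) (nats s2 ''fw_at_pivot'' 0)"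
      using \<open>I j s2\<close> going by (auto simp: I_def)
    note f = frameD[OF fr, simplified]
    have s2: "nats s2 ''n'' 0 = n" "reals s2 ''x'' = X" "reals s2 ''y'' = Y" using f s1 by simp_all
    show "achieves walk_step s2 ?B (\<lambda>s3. \<exists>j'<j. I j' s3)"
    proof (rule achieves_mono[OF walk_step_correct[OF s2(1) c(2) s2(2,3) inj c(1) L] order_refl])
      fix s3 :: state
      assume "nats s3 ''member'' 0 = mark (pivot (pts X Y n) (pt X Y c)) (nats s2 ''member'' 0) \<and>
         nats s3 ''fw_at_pivot'' 0 = mark (pivot (pts X Y n) (pt X Y c) \<and>
           norm (unit_sum (pts X Y n) (pt X Y c)) \<le> 1) (nats s2 ''fw_at_pivot'' 0) \<and>
         (\<exists>q<n. next_on_chain X Y n c q \<and>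
              (if q = c then nats s3 ''c'' 0 = c \<and> nats s3 ''done'' 0 = 1
               else nats s3 ''c'' 0 = q \<and> nats s3 ''done'' = nats s2 ''done''))"
      then obtain q where m: "nats s3 ''member'' 0 = mark (G c) (nats s2 ''member'' 0)"
        "nats s3 ''fw_at_pivot'' 0 = mark (F c) (nats s2 ''fw_at_pivot'' 0)"
        and q: "q < n" "next_on_chain X Y n c q"
        and moved: "if q = c then nats s3 ''c'' 0 = c \<and> nats s3 ''done'' 0 = 1
               else nats s3 ''c'' 0 = q \<and> nats s3 ''done'' = nats s2 ''done''"
        unfolding G_def F_def T_def by blast
      note mark = flag_covers_mark[OF flags(1) c(1)] flag_covers_mark[OF flags(2) c(1)]
      show "\<exists>j'<j. I j' s3"
      proof (cases "q = c")
        case True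
        then have last: "lex_less X Y e c \<or> e = c" if "e < n" for e
          using q(2) lex_less_total[OF inj that c(1)] that by (auto simp: next_on_chain_def)
        have "pot c 1 < pot c 0" by (simp add: pot_def)
        with pot have "pot c 1 < j" by linarith
        moreover have "I (pot c 1) s3"
          unfolding I_def m
          by (intro exI[of _ c] conjI mark) (use True moved c(1) edge last in auto)
        ultimately show ?thesis by blast
      next
        case False
        note step = chain_step[OF inj c(1) q(1) False q(2) edge]
        have cq: "lex_less X Y c q" using q(2) False by (auto simp: next_on_chain_def)
        have passed: "lex_less X Y e c \<or> e = c" if "e < n" "exposed_below X Y n e" "lex_less X Y e q" for e
          using chain_skips_none[OF c(1) q that(1,2)] lex_less_total[OF inj that(1) c(1)] that(3) by blast
        have I: "I (pot q 0) s3"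
          unfolding I_def m
          by (intro exI[of _ q] conjI mark) (use False moved going q(1) step(1) passed in auto)
        have not_left: "\<not> leftmost X Y n q" using cq c(1) by (auto simp: leftmost_def)
        let ?E = "\<lambda>c. {e. e < n \<and> exposed X Y n e \<and> \<not> lex_less X Y e c}"
        have sub: "?E q \<subseteq> ?E c" using cq lex_less_trans by blast
        have "pot q 0 < pot c 0"
        proof (cases "leftmost X Y n c")
          case True
          then show ?thesis using card_mono[OF _ sub] not_left by (simp add: pot_def)
        next
          case nl: False
          then have "c \<in> ?E c" "c \<notin> ?E q" using step(2) c(1) cq by auto
          then have "card (?E q) < card (?E c)" using sub by (intro psubset_card_mono) auto
          then show ?thesis using nl not_left by (simp add: pot_def)
        qed
        with pot I show ?thesis by (meson less_le_trans)
      qed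
    qed
  next
    fix j s2 assume "I j s2" "\<not> bval (NEq (NVar ''done'') (NConst 0)) s2"
    then show "?Q s2" by (auto simp: I_def)
  qed (simp add: algebra_simps)
  show ?thesis
    unfolding walk_lower_hull_def
  proof (rule achieves_Seq_exec)
    let ?s = "exec (NSet ''done'' (NConst 0)) s"
    show "achieves (Seq find_leftmost (Loop (NEq (NVar ''done'') (NConst 0)) walk_step)) ?s
       (n * 100 + 20 + ((H + 2) * (?B + 5) + 5)) ?Q"
    proof (rule achieves_Seq[OF find_leftmost_correct[where X = X and Y = Y and n = n]])
      fix s1 assume c: "nats s1 ''c'' 0 < n \<and> leftmost X Y n (nats s1 ''c'' 0)"
        and "frame find_leftmost ?s s1"
      note f = frameD[OF this(2), simplified]
      show "achieves (Loop (NEq (NVar ''done'') (NConst 0)) walk_step) s1 ((H + 2) * (?B + 5) + 5) ?Q"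
      proof (rule loop)
        show "nats s1 ''n'' 0 = n" "reals s1 ''x'' = X" "reals s1 ''y'' = Y" "nats s1 ''done'' 0 = 0"
          "nats s1 ''member'' = nats s ''member''" "nats s1 ''fw_at_pivot'' = nats s ''fw_at_pivot''"
          using f(1)[of "''n''"] f(1)[of "''done''"] f(1)[of "''member''"] f(1)[of "''fw_at_pivot''"]
            f(2) s by simp_all
      qed (use c in simp_all)
    qed (use s n in simp_all)
    have worst: "worst_cost (NSet ''done'' (NConst 0)) = 3" by simp
    define D where "D = (H + 2) * (n * (L + 1))"
    have "n * 1 \<le> n * (L + 1)" by (rule mult_le_mono2) simp
    then have "n \<le> n * (L + 1)" by simp
    moreover have "1 * (n * (L + 1)) \<le> D" unfolding D_def by (rule mult_le_mono1) simp
    ultimately have nD: "n \<le> D" by linarith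
    have "(H + 2) * 1 \<le> D" unfolding D_def using n by (intro mult_le_mono2) simp
    then have HD: "H + 2 \<le> D" by simp
    have "3 + (n * 100 + 20 + ((H + 2) * (?B + 5) + 5)) = 1500 * D + 5 * (H + 2) + 100 * n + 28"
      by (simp add: D_def algebra_simps)
    also have "\<dots> \<le> 3000 * D" using nD HD by simp
    finally show "worst_cost (NSet ''done'' (NConst 0)) + (n * 100 + 20 + ((H + 2) * (?B + 5) + 5))
        \<le> 3000 * (H + 2) * n * (L + 1)"
      by (simp only: D_def mult.assoc worst)
  qed simp
qed

section \<open>The complete algorithm\<close>

definition negate_input :: com where
  "negate_input = for_all_inputs
     (Seq (RStore ''x'' (NVar ''i'') (RSub (RConst 0) (RLoad ''x'' (NVar ''i''))))
          (RStore ''y'' (NVar ''i'') (RSub (RConst 0) (RLoad ''y'' (NVar ''i'')))))"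

definition decide_pivots :: com where
  "decide_pivots = Seq walk_lower_hull (Seq negate_input walk_lower_hull)"

lemma mods_negate_input [simp]: "nmods negate_input = {''i''}" "rmods negate_input = {''x'', ''y''}"
  by (auto simp: negate_input_def)

lemma negate_input_correct:
  assumes s: "nats s ''n'' 0 = n" "reals s ''x'' = X" "reals s ''y'' = Y"
  shows "achieves negate_input s (n * 30 + 10)
    (\<lambda>s'. \<forall>i<n. reals s' ''x'' i = - X i \<and> reals s' ''y'' i = - Y i)"
  unfolding negate_input_def
proof (rule achieves_for_all_inputs[where I = "\<lambda>j s'. \<forall>i.
      reals s' ''x'' i = (if i < j then - X i else X i) \<and> reals s' ''y'' i = (if i < j then - Y i else Y i)"])
qed (use s in auto)

lemma pt_negated: "X' i = - X i \<Longrightarrow> Y' i = - Y i \<Longrightarrow> pt X' Y' i = - pt X Y i"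
  by (simp add: pt_def vec_eq_iff forall_2)

lemma unit_sum_uminus: "unit_sum (uminus ` T) (- p) = - unit_sum T p"
proof -
  have "sgn (- r + p) = - sgn (r - p)" for r :: "real^2"
    using sgn_minus[of "r - p"] by (simp add: algebra_simps)
  then show ?thesis by (simp add: unit_sum_def sum.reindex sum_negf)
qed

lemma pivot_uminus: "pivot (uminus ` T) (- p) \<longleftrightarrow> pivot T p"
proof -
  have slope: "slope (- v) (- r - - p) = slope v (r - p)" for v r
    by (simp add: slope_def cross2_def inner_diff_right algebra_simps)
  have inner: "(- v) \<bullet> (- r - - p) = v \<bullet> (r - p)" for v r :: "real^2"
    by (simp add: inner_diff_right)
  have set: "uminus ` T - {- p} = uminus ` (T - {p})" by auto
  have key: "(\<lambda>r. slope (- v) (r - - p)) ` uminus ` T = (\<lambda>r. slope v (r - p)) ` T" for v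
    unfolding image_image slope ..
  have inj: "inj_on (\<lambda>r. slope (- v) (r - - p)) (uminus ` T) \<longleftrightarrow> inj_on (\<lambda>r. slope v (r - p)) T" for v
    using comp_inj_on_iff[of uminus T "\<lambda>r. slope (- v) (r - - p)"] slope
    by (simp add: comp_def del: diff_minus_eq_add)
  show ?thesis
    unfolding pivot_def Let_def unit_sum_uminus key inj set ball_simps(9) inner ..
qed

lemma hull_size_pos:
  assumes "finite T" "T \<noteq> {}"
  shows "0 < hull_size T"
proof -
  obtain x where "x extreme_point_of (convex hull T)"
    using extreme_point_exists_convex[of "convex hull T"] assms finite_imp_compact_convex_hull
    by (metis convex_convex_hull convex_hull_eq_empty)
  then have "{z \<in> T. z extreme_point_of (convex hull T)} \<noteq> {}"
    using extreme_point_of_convex_hull by blast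
  then show ?thesis unfolding hull_size_def using assms(1) by (simp add: card_gt_0_iff)
qed

text \<open>Being strictly minimal for some linear function makes a point a vertex of the hull.\<close>

lemma card_exposed_le:
  assumes inj: "inj_on (pt X Y) {..<n}"
  shows "card {e. e < n \<and> exposed X Y n e} \<le> hull_size (pts X Y n)"
proof -
  let ?E = "{e. e < n \<and> exposed X Y n e}"
  have "pt X Y ` ?E \<subseteq> {z \<in> pts X Y n. z extreme_point_of (convex hull pts X Y n)}"
  proof clarsimp
    fix e assume e: "e < n" "exposed X Y n e"
    then obtain f where f: "separates f X Y n e" by (auto simp: exposed_def)
    have "pt X Y e extreme_point_of (convex hull pts X Y n)"
      by (rule hull_vertex_if_exposed[where f = f]) (use e f in \<open>auto simp: pts_def separates_def\<close>)
    then show "pt X Y e \<in> pts X Y n \<and> pt X Y e extreme_point_of (convex hull pts X Y n)"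
      using e by (simp add: pts_def)
  qed
  moreover have "inj_on (pt X Y) ?E" by (rule inj_on_subset[OF inj]) auto
  ultimately show ?thesis
    unfolding hull_size_def by (intro card_inj_on_le) (auto simp: pts_def)
qed

text \<open>A pivot is strictly minimal for the function with gradient \<open>unit_sum T p\<close>.  Depending on the sign of the
second coordinate of the gradient, it is exposed from below in the input or in the negated input.\<close>

lemma decide_pivots_correct:
  assumes s: "nats s ''n'' 0 = n" "reals s ''x'' = X" "reals s ''y'' = Y"
      "nats s ''member'' 0 = 0" "nats s ''fw_at_pivot'' 0 = 0"
    and inj: "inj_on (pt X Y) {..<n}" and n: "0 < n" and L: "n \<le> 2 ^ L"
  defines "T \<equiv> pts X Y n"
  shows "achieves decide_pivots s (7000 * (hull_size T + 2) * n * (L + 1))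
     (\<lambda>s'. (nats s' ''member'' 0 = 1 \<longleftrightarrow> (\<exists>p\<in>T. pivot T p)) \<and>
           (nats s' ''fw_at_pivot'' 0 = 1 \<longleftrightarrow> (\<exists>p\<in>T. pivot T p \<and> norm (unit_sum T p) \<le> 1)))"
    (is "achieves _ _ _ ?Q")
proof -
  define G where "G e = pivot T (pt X Y e)" for e
  define F where "F e \<longleftrightarrow> pivot T (pt X Y e) \<and> norm (unit_sum T (pt X Y e)) \<le> 1" for e
  define H where "H = card {e. e < n \<and> exposed X Y n e}"
  let ?B = "3000 * (H + 2) * n * (L + 1)"
  have H: "H \<le> hull_size T" unfolding H_def T_def by (rule card_exposed_le[OF inj])
  have below_or_above: "exposed_below X Y n e \<or> (\<exists>f. f $ 2 \<le> 0 \<and> separates f X Y n e)"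
    if "e < n" "G e" for e
  proof -
    have "separates (unit_sum T (pt X Y e)) X Y n e"
      using that(2) pivot_pts_iff[OF inj that(1)] by (simp add: G_def T_def separates_def)
    then show ?thesis by (meson exposed_below_def linear)
  qed
  have second: "achieves walk_lower_hull s2 ?B ?Q"
    if s2: "nats s2 ''n'' 0 = n" "\<forall>i<n. reals s2 ''x'' i = - X i \<and> reals s2 ''y'' i = - Y i"
      and flags: "flag_covers X Y n G 0 (\<lambda>_. True) (nats s2 ''member'' 0)"
        "flag_covers X Y n F 0 (\<lambda>_. True) (nats s2 ''fw_at_pivot'' 0)" for s2
  proof -
    define X' Y' where "X' = reals s2 ''x''" and "Y' = reals s2 ''y''"
    have neg: "pt X' Y' i = - pt X Y i" if "i < n" for i
      using s2(2) that by (intro pt_negated) (auto simp: X'_def Y'_def)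
    have T': "pts X' Y' n = uminus ` T"
      unfolding pts_def T_def image_image using neg by (intro image_cong) auto
    have inj': "inj_on (pt X' Y') {..<n}"
      using inj neg by (simp add: inj_on_def)
    have sep: "separates f X' Y' n e \<longleftrightarrow> separates (- f) X Y n e" if "e < n" for f e
      unfolding separates_def using that neg by (auto simp: inner_diff_right)
    have exposed': "exposed X' Y' n e \<longleftrightarrow> exposed X Y n e" if "e < n" for e
      unfolding exposed_def sep[OF that] by (metis minus_minus)
    have H': "card {e. e < n \<and> exposed X' Y' n e} = H"
      unfolding H_def using exposed' by (intro arg_cong[where f = card]) auto
    have G': "pivot (pts X' Y' n) (pt X' Y' e) \<longleftrightarrow> G e"
      and F': "norm (unit_sum (pts X' Y' n) (pt X' Y' e)) = norm (unit_sum T (pt X Y e))" if "e < n" for e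
      using neg[OF that] by (simp_all add: T' pivot_uminus unit_sum_uminus G_def)
    have above: "exposed_below X' Y' n e" if "e < n" "f $ 2 \<le> 0" "separates f X Y n e" for e f
      unfolding exposed_below_def using that sep[of e "- f"] by (intro exI[of _ "- f"]) auto
    show ?thesis
    proof (rule achieves_mono[OF walk_lower_hull_correct[OF s2(1) X'_def[symmetric] Y'_def[symmetric] inj' n L]])
      fix s3 :: state
      assume *: "flag_covers X' Y' n (\<lambda>e. pivot (pts X' Y' n) (pt X' Y' e)) (nats s2 ''member'' 0)
          (\<lambda>_. True) (nats s3 ''member'' 0) \<and>
        flag_covers X' Y' n (\<lambda>e. pivot (pts X' Y' n) (pt X' Y' e) \<and>
          norm (unit_sum (pts X' Y' n) (pt X' Y' e)) \<le> 1) (nats s2 ''fw_at_pivot'' 0)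
          (\<lambda>_. True) (nats s3 ''fw_at_pivot'' 0)"
      have all: "new = 1 \<longleftrightarrow> (\<exists>i<n. P i)"
        if "flag_covers X Y n P 0 (\<lambda>_. True) old" "flag_covers X' Y' n P' old (\<lambda>_. True) new"
          "\<And>i. i < n \<Longrightarrow> P' i \<longleftrightarrow> P i" "\<And>i. P i \<Longrightarrow> G i" for P P' old new
        using that below_or_above above unfolding flag_covers_def by (metis zero_neq_one)
      have "nats s3 ''member'' 0 = 1 \<longleftrightarrow> (\<exists>i<n. G i)"
        by (rule all[OF flags(1) conjunct1[OF *]]) (use G' in auto)
      moreover have "nats s3 ''fw_at_pivot'' 0 = 1 \<longleftrightarrow> (\<exists>i<n. F i)"
        by (rule all[OF flags(2) conjunct2[OF *]]) (use G' F' in \<open>auto simp: F_def G_def\<close>)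
      moreover have "(\<exists>p\<in>T. P p) \<longleftrightarrow> (\<exists>i<n. P (pt X Y i))" for P
        by (auto simp: T_def pts_def)
      ultimately show "?Q s3" by (simp add: G_def F_def)
    qed (simp add: H')
  qed
  show ?thesis
    unfolding decide_pivots_def
  proof (rule achieves_Seq[OF walk_lower_hull_correct[OF s(1-3) inj n L]])
    fix s1
    assume flags: "flag_covers X Y n (\<lambda>e. pivot (pts X Y n) (pt X Y e)) (nats s ''member'' 0) (\<lambda>_. True)
          (nats s1 ''member'' 0) \<and>
        flag_covers X Y n (\<lambda>e. pivot (pts X Y n) (pt X Y e) \<and> norm (unit_sum (pts X Y n) (pt X Y e)) \<le> 1)
          (nats s ''fw_at_pivot'' 0) (\<lambda>_. True) (nats s1 ''fw_at_pivot'' 0)"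
      and "frame walk_lower_hull s s1"
    note f1 = frameD[OF this(2), simplified]
    have s1: "nats s1 ''n'' 0 = n" "reals s1 ''x'' = X" "reals s1 ''y'' = Y"
      using f1 s by simp_all
    show "achieves (Seq negate_input walk_lower_hull) s1 (n * 30 + 10 + ?B) ?Q"
    proof (rule achieves_Seq[OF negate_input_correct[OF s1] second])
      fix s2 assume "frame negate_input s1 s2"
      note f2 = frameD[OF this, simplified]
      show "nats s2 ''n'' 0 = n" using f2 s1 by simp
      show "flag_covers X Y n G 0 (\<lambda>_. True) (nats s2 ''member'' 0)"
        "flag_covers X Y n F 0 (\<lambda>_. True) (nats s2 ''fw_at_pivot'' 0)"
        using flags f2 s(4,5) by (simp_all add: G_def[abs_def] F_def[abs_def] T_def)
    qed auto
  next
    define D where "D = (H + 2) * (n * (L + 1))"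
    have "n * 1 \<le> n * (L + 1)" by (rule mult_le_mono2) simp
    moreover have "1 * (n * (L + 1)) \<le> D" unfolding D_def by (rule mult_le_mono1) simp
    ultimately have "n \<le> D" by linarith
    have "?B + (n * 30 + 10 + ?B) = 6000 * D + 30 * n + 10" by (simp add: D_def algebra_simps)
    also have "\<dots> \<le> 7000 * D" using \<open>n \<le> D\<close> n by simp
    also have "\<dots> \<le> 7000 * ((hull_size T + 2) * (n * (L + 1)))"
      unfolding D_def using H by (intro mult_le_mono) auto
    finally show "3000 * (card {e. e < n \<and> exposed X Y n e} + 2) * n * (L + 1) + (n * 30 + 10 + ?B)
        \<le> 7000 * (hull_size T + 2) * n * (L + 1)"
      by (simp only: H_def mult.assoc)
  qed
qed

theorem theorem5:
  shows "\<exists>(alg :: com) (C :: real). \<forall>(T :: (real^2) set) (k :: nat) (m :: nat) (h :: nat) ps.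
    finite T \<and> card T = k \<and> k = 2 * m + 1 \<and> m \<ge> 1 \<and> hull_size T = h \<and>
    distinct ps \<and> set ps = T \<longrightarrow>
    (\<exists>t s. runs alg (input_state ps) t s \<and>
       real t \<le> C * (real h * real k * log 2 (real k)) \<and>
       (answers_yes ''member'' s \<longleftrightarrow>
          (\<exists>S s0. reflection_symmetric S s0 \<and> T \<in> extension S s0)) \<and>
       ((\<exists>S s0. reflection_symmetric S s0 \<and> T \<in> extension S s0) \<longrightarrow>
          (answers_yes ''fw_at_pivot'' s \<longleftrightarrow>
             (\<exists>S s0. reflection_symmetric S s0 \<and> T \<in> extension S s0 \<and>
                fermat_weber_point T s0))))"
proof (intro exI[of _ decide_pivots] exI[of _ "63000 :: real"] allI impI, elim conjE)
  fix T :: "(real^2) set" and k m h :: nat and ps :: "(real^2) list"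
  assume T: "finite T" "card T = k" "hull_size T = h" and k: "k = 2 * m + 1" "m \<ge> 1"
    and ps: "distinct ps" "set ps = T"
  define X Y where "X = reals (input_state ps) ''x''" and "Y = reals (input_state ps) ''y''"
  have len: "length ps = k" using T ps distinct_card by fastforce
  have pt: "pt X Y i = ps ! i" if "i < k" for i
    using that by (simp add: X_def Y_def input_state_def len vec_eq_iff forall_2)
  have pts: "pts X Y k = T"
    using pt ps(2) len unfolding pts_def by (auto simp: set_conv_nth image_iff)
  have inj: "inj_on (pt X Y) {..<k}"
    using pt ps(1) len by (auto simp: inj_on_def nth_eq_iff_index_eq)
  define L where "L = nat \<lceil>log 2 (real k)\<rceil>"
  have k3: "3 \<le> k" using k by simp
  have log1: "1 \<le> log 2 (real k)" using k3 by (simp add: le_log_iff)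
  have L: "log 2 (real k) \<le> real L" "real L \<le> log 2 (real k) + 1"
    using log1 by (simp_all add: L_def)
  have "real k \<le> 2 powr real L" using L(1) k3 by (simp add: log_le_iff)
  then have "real k \<le> 2 ^ L" by (simp add: powr_realpow)
  then have kL: "k \<le> 2 ^ L" by (metis of_nat_le_iff of_nat_numeral of_nat_power)
  have "achieves decide_pivots (input_state ps) (7000 * (hull_size (pts X Y k) + 2) * k * (L + 1))
     (\<lambda>s'. (nats s' ''member'' 0 = 1 \<longleftrightarrow> (\<exists>p\<in>pts X Y k. pivot (pts X Y k) p)) \<and>
           (nats s' ''fw_at_pivot'' 0 = 1 \<longleftrightarrow>
             (\<exists>p\<in>pts X Y k. pivot (pts X Y k) p \<and> norm (unit_sum (pts X Y k) p) \<le> 1)))"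
    using k3 by (intro decide_pivots_correct inj kL) (simp_all add: X_def Y_def, simp_all add: input_state_def len)
  then obtain t s where run: "runs decide_pivots (input_state ps) t s"
    and t: "t \<le> 7000 * (h + 2) * k * (L + 1)"
    and member: "nats s ''member'' 0 = 1 \<longleftrightarrow> (\<exists>p\<in>T. pivot T p)"
    and fw: "nats s ''fw_at_pivot'' 0 = 1 \<longleftrightarrow> (\<exists>p\<in>T. pivot T p \<and> norm (unit_sum T p) \<le> 1)"
    unfolding achieves_def pts T(3) by blast
  have in_T: "p \<in> T" if "T \<in> extension S p" for S p using that by (auto simp: extension_def)
  have pivots: "(\<exists>S. reflection_symmetric S p \<and> T \<in> extension S p) \<longleftrightarrow> p \<in> T \<and> pivot T p" for p
    using pivot_if_extension extension_if_pivot[OF T(1) T(2)[unfolded k(1)] k(2)] in_T by blast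
  have "T \<noteq> {}" using T k3 by auto
  then have h: "1 \<le> h" using hull_size_pos[OF T(1)] T(3) by simp
  have "real t \<le> 7000 * (real h + 2) * real k * (real L + 1)"
    using t by (metis (mono_tags, lifting) of_nat_1 of_nat_add of_nat_le_iff of_nat_mult of_nat_numeral)
  \<comment> \<open>the additive terms are absorbed using \<open>1 \<le> h\<close> and \<open>1 \<le> log 2 k\<close>, the latter because \<open>3 \<le> k\<close>\<close>
  also have "\<dots> \<le> 7000 * (3 * real h) * real k * (3 * log 2 (real k))"
    using h L log1 by (intro mult_mono) auto
  also have "\<dots> = 63000 * (real h * real k * log 2 (real k))" by simp
  finally have time: "real t \<le> 63000 * (real h * real k * log 2 (real k))" .
  have fw_iff: "(\<exists>S p. reflection_symmetric S p \<and> T \<in> extension S p \<and> fermat_weber_point T p) \<longleftrightarrow>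
      (\<exists>p\<in>T. pivot T p \<and> norm (unit_sum T p) \<le> 1)"
    using pivots fermat_weber_point_iff[OF T(1)] by blast
  have member_iff: "(\<exists>S p. reflection_symmetric S p \<and> T \<in> extension S p) \<longleftrightarrow> (\<exists>p\<in>T. pivot T p)"
    using pivots by blast
  show "\<exists>t s. runs decide_pivots (input_state ps) t s \<and>
       real t \<le> 63000 * (real h * real k * log 2 (real k)) \<and>
       (answers_yes ''member'' s \<longleftrightarrow>
          (\<exists>S s0. reflection_symmetric S s0 \<and> T \<in> extension S s0)) \<and>
       ((\<exists>S s0. reflection_symmetric S s0 \<and> T \<in> extension S s0) \<longrightarrow>
          (answers_yes ''fw_at_pivot'' s \<longleftrightarrow>
             (\<exists>S s0. reflection_symmetric S s0 \<and> T \<in> extension S s0 \<and>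
                fermat_weber_point T s0)))"
    using run time member fw unfolding answers_yes_def member_iff fw_iff by blast
qed

end
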